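(* Let $\mathcal{F}$ be a family of graphs, each with at most four vertices, such that $\mathcal{F}\neq\{4P_1, C_4\}$ and $\mathcal{F}\neq\{4P_1,\text{claw},C_4\}$. Then the class of $\mathcal{F}$-free graphs is tame if and only if $\mathcal{F}\trianglelefteq\mathcal{F}'$ for one of the following families $\mathcal{F}'$: (i) $\mathcal{F}'=\{P_4\}$ or $\mathcal{F}'=\{2P_2\}$; (ii) $\mathcal{F}'=\{F,\text{paw}\}$ for some $F\in\{4P_1,\ P_2+2P_1,\ P_3+P_1,\ \text{claw}\}$; (iii) $\mathcal{F}'=\{F,K_3+P_1\}$ for some $F\in\{4P_1,\ P_2+2P_1,\ P_3+P_1,\ \text{claw}\}$; (iv) $\mathcal{F}'=\{F,K_4\}$ for some $F\in\{4P_1,\ P_2+2P_1,\ P_3+P_1\}$; (v) $\mathcal{F}'=\{F,C_4\}$ for some $F\in\{P_2+2P_1,\ P_3+P_1\}$; (vi) $\mathcal{F}'=\{4P_1,C_4,\text{diamond}\}$.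
   Context: All graphs are finite, simple, undirected, and have at least one vertex; members of families of graphs are considered up to isomorphism. For non-adjacent vertices $a,b$ of $G$, a set $S\subseteq V(G)\setminus\{a,b\}$ is an $a,b$-separator if $a$ and $b$ lie in different connected components of $G-S$; it is a minimal $a,b$-separator if no proper subset of $S$ is an $a,b$-separator. A minimal separator in $G$ is a set that is a minimal $a,b$-separator for some pair of non-adjacent vertices $a,b$. Let $s(G)$ denote the number of minimal separators in $G$. A class $\mathcal{G}$ of graphs is tame if there is a polynomial $p:\mathbb{R}\to\mathbb{R}$ such that $s(G)\le p(|V(G)|)$ for every $G\in\mathcal{G}$. A graph is $\mathcal{F}$-free if none of its induced subgraphs is isomorphic to a member of $\mathcal{F}$. For two families $\mathcal{F},\mathcal{F}'$ write $\mathcal{F}\trianglelefteq\mathcal{F}'$ if every $\mathcal{F}$-free graph is also $\mathcal{F}'$-free (equivalently, every graph in $\mathcal{F}'$ contains an induced subgraph isomorphic to a member of $\mathcal{F}$). $P_n, C_n, K_n$ denote the path, cycle, and complete graph on $n$ vertices; $G+H$ is disjoint union and $kG$ is the disjoint union of $k$ copies of $G$. The claw is $K_{1,3}$; the paw is the graph obtained from a triangle by adding one new vertex adjacent to exactly one vertex of the triangle; the diamond is $K_4$ minus one edge. *)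

theory Defs
  imports "HOL-Computational_Algebra.Polynomial"
begin

record 'v graph =
  verts :: "'v set"
  edges :: "'v set set"

definition simple_graph :: "'v graph \<Rightarrow> bool" where
  "simple_graph G \<longleftrightarrow>
     finite (verts G) \<and> verts G \<noteq> {} \<and> edges G \<subseteq> {e. e \<subseteq> verts G \<and> card e = 2}"

definition adjacent :: "'v graph \<Rightarrow> 'v \<Rightarrow> 'v \<Rightarrow> bool" where
  "adjacent G u v \<longleftrightarrow> {u, v} \<in> edges G"

definition graph_iso :: "'v graph \<Rightarrow> 'w graph \<Rightarrow> bool" where
  "graph_iso G H \<longleftrightarrow>
     (\<exists>f. bij_betw f (verts G) (verts H) \<and>
          (\<forall>u\<in>verts G. \<forall>v\<in>verts G. adjacent G u v \<longleftrightarrow> adjacent H (f u) (f v)))"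

definition induced :: "'v graph \<Rightarrow> 'v set \<Rightarrow> 'v graph" where
  "induced G W = \<lparr>verts = W, edges = {e \<in> edges G. e \<subseteq> W}\<rparr>"

definition delete_verts :: "'v graph \<Rightarrow> 'v set \<Rightarrow> 'v graph" where
  "delete_verts G S = induced G (verts G - S)"

definition component :: "'v graph \<Rightarrow> 'v \<Rightarrow> 'v set" where
  "component G v = {w \<in> verts G. (adjacent G)\<^sup>*\<^sup>* v w}"

definition separator :: "'v graph \<Rightarrow> 'v \<Rightarrow> 'v \<Rightarrow> 'v set \<Rightarrow> bool" where
  "separator G a b S \<longleftrightarrow>
     S \<subseteq> verts G - {a, b} \<and>
     component (delete_verts G S) a \<noteq> component (delete_verts G S) b"

definition minimal_ab_separator :: "'v graph \<Rightarrow> 'v \<Rightarrow> 'v \<Rightarrow> 'v set \<Rightarrow> bool" where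
  "minimal_ab_separator G a b S \<longleftrightarrow>
     separator G a b S \<and> (\<forall>T. T \<subset> S \<longrightarrow> \<not> separator G a b T)"

definition minimal_separator :: "'v graph \<Rightarrow> 'v set \<Rightarrow> bool" where
  "minimal_separator G S \<longleftrightarrow>
     (\<exists>a\<in>verts G. \<exists>b\<in>verts G. a \<noteq> b \<and> \<not> adjacent G a b \<and> minimal_ab_separator G a b S)"

definition num_min_seps :: "'v graph \<Rightarrow> nat" where
  "num_min_seps G = card {S. minimal_separator G S}"

definition tame :: "'v graph set \<Rightarrow> bool" where
  "tame \<G> \<longleftrightarrow>
     (\<exists>p :: real poly. \<forall>G\<in>\<G>. real (num_min_seps G) \<le> poly p (real (card (verts G))))"

definition is_free :: "'w graph set \<Rightarrow> 'v graph \<Rightarrow> bool" where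
  "is_free \<F> G \<longleftrightarrow> \<not> (\<exists>W \<subseteq> verts G. \<exists>H\<in>\<F>. graph_iso (induced G W) H)"

text \<open>
  Every finite graph is isomorphic to one whose vertices are natural numbers, so
  classes and families of graphs are taken over \<^typ>\<open>nat graph\<close>.
\<close>

definition free_class :: "nat graph set \<Rightarrow> nat graph set" where
  "free_class \<F> = {G. simple_graph G \<and> is_free \<F> G}"

definition family_le :: "nat graph set \<Rightarrow> nat graph set \<Rightarrow> bool" (infix "\<unlhd>" 50) where
  "\<F> \<unlhd> \<F>' \<longleftrightarrow> (\<forall>G :: nat graph. simple_graph G \<and> is_free \<F> G \<longrightarrow> is_free \<F>' G)"

text \<open>Equality of families whose members are considered up to isomorphism.\<close>

definition family_eq :: "nat graph set \<Rightarrow> nat graph set \<Rightarrow> bool" where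
  "family_eq \<F> \<F>' \<longleftrightarrow>
     (\<forall>G\<in>\<F>. \<exists>H\<in>\<F>'. graph_iso G H) \<and> (\<forall>H\<in>\<F>'. \<exists>G\<in>\<F>. graph_iso G H)"

definition path_graph :: "nat \<Rightarrow> nat graph" where
  "path_graph n = \<lparr>verts = {..<n}, edges = {{i, Suc i} |i. Suc i < n}\<rparr>"

text \<open>Meaningful only for \<open>n \<ge> 3\<close>.\<close>

definition cycle_graph :: "nat \<Rightarrow> nat graph" where
  "cycle_graph n = \<lparr>verts = {..<n}, edges = {{i, Suc i mod n} |i. i < n}\<rparr>"

definition complete_graph :: "nat \<Rightarrow> nat graph" where
  "complete_graph n = \<lparr>verts = {..<n}, edges = {{i, j} |i j. i < j \<and> j < n}\<rparr>"

definition complete_bipartite :: "nat \<Rightarrow> nat \<Rightarrow> nat graph" where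
  "complete_bipartite m n =
     \<lparr>verts = {..<m + n}, edges = {{i, j} |i j. i < m \<and> m \<le> j \<and> j < m + n}\<rparr>"

definition map_graph :: "('v \<Rightarrow> 'w) \<Rightarrow> 'v graph \<Rightarrow> 'w graph" where
  "map_graph f G = \<lparr>verts = f ` verts G, edges = (\<lambda>e. f ` e) ` edges G\<rparr>"

text \<open>
  To stay inside \<^typ>\<open>nat graph\<close>, the two sides of a disjoint union are moved to the
  even and to the odd numbers.
\<close>

definition disj_union :: "nat graph \<Rightarrow> nat graph \<Rightarrow> nat graph" (infixl "\<oplus>" 65) where
  "G \<oplus> H =
     (let G' = map_graph (\<lambda>v. 2 * v) G; H' = map_graph (\<lambda>v. 2 * v + 1) H
      in \<lparr>verts = verts G' \<union> verts H', edges = edges G' \<union> edges H'\<rparr>)"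

primrec copies :: "nat \<Rightarrow> nat graph \<Rightarrow> nat graph" where
  "copies 0 G = \<lparr>verts = {}, edges = {}\<rparr>"
| "copies (Suc k) G = G \<oplus> copies k G"

definition claw :: "nat graph" where
  "claw = complete_bipartite 1 3"

definition paw :: "nat graph" where
  "paw = \<lparr>verts = {0, 1, 2, 3}, edges = {{0, 1}, {0, 2}, {1, 2}, {0, 3}}\<rparr>"

definition diamond :: "nat graph" where
  "diamond = (complete_graph 4)\<lparr>edges := edges (complete_graph 4) - {{0, 1}}\<rparr>"

end

theory Submission
  imports Defs
begin

text \<open>
  A minimal separator \<open>S\<close> has two full components \<open>A\<close> and \<open>B\<close>: connected pieces of \<open>G - S\<close> whose
  neighbourhood is all of \<open>S\<close> (\<open>minimal_separator_full_pair\<close>).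

  Tameness comes from short descriptions.  Every vertex with neighbours in both \<open>A\<close> and \<open>B\<close> lies in
  \<open>S\<close>.  So if boundedly many vertices of \<open>A\<close>, and of \<open>B\<close>, suffice to reach all of \<open>S\<close>, or if one
  of \<open>A\<close>, \<open>B\<close>, \<open>S\<close> has bounded size, then \<open>S\<close> is determined by boundedly many vertices, and there
  are only polynomially many possibilities (\<open>tame_if_described\<close>).  Each listed family forces this.
  If P4 is forbidden, \<open>S\<close> is complete to both components; if 2P2 is forbidden, one component is a
  single vertex.  If 4P1, P2 + 2P1 or P3 + P1 is forbidden, then the graph has no induced 2P3, so one
  component is a clique, which has at most three vertices when in addition the paw, K3 + P1 or K4 is
  forbidden and \<open>S\<close> is not empty.  Forbidding the claw together with the paw or K3 + P1 turns large
  components into paths whose ends carry \<open>S\<close>, so \<open>S\<close> has at most two vertices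
  (\<open>claw_free_small\<close>).  When C4 is forbidden, vertices of \<open>S\<close> with incomparable neighbourhoods in a
  clique are not adjacent, so a clique needs only as many vertices to reach \<open>S\<close> as \<open>S\<close> has independent
  vertices (\<open>clique_hitting_set\<close>); in each C4 case this number is at most three and the components are
  covered by at most three cliques.

  Conversely, take two copies of a graph and a matching between \<open>n\<close> pairs of corresponding vertices
  such that in each copy the unmatched vertices are connected and every matched vertex has a
  neighbour among them.  Choosing one end of every matching edge gives \<open>2 ^ n\<close> minimal separators
  (\<open>num_min_seps_twin\<close>).  For the star this yields a graph with neither triangles nor C4, for the
  complete graph a graph with neither three independent vertices nor diamonds, and for a chain of
  triangles a graph without claw, K4, C4 and diamond.  The family of a tame class has a member inside
  each of them.  The classification of graphs on at most four vertices shows that this leaves only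
  the listed families and the two excluded ones.
\<close>

section \<open>Adjacency and induced embeddings\<close>

lemma adjacent_sym: "adjacent G u v \<Longrightarrow> adjacent G v u"
  by (simp add: adjacent_def insert_commute)

lemma adjacent_commute: "adjacent G u v \<longleftrightarrow> adjacent G v u"
  by (metis adjacent_sym)

lemma adjacent_verts:
  assumes "simple_graph G" "adjacent G u v"
  shows "u \<in> verts G" "v \<in> verts G" "u \<noteq> v"
  using assms by (auto simp: simple_graph_def adjacent_def)

lemma adjacent_irrefl: "simple_graph G \<Longrightarrow> \<not> adjacent G u u"
  using adjacent_verts(3) by fastforce

text \<open>
  Forbidding induced subgraphs is handled through injections instead of vertex subsets, because
  embeddings compose.
\<close>

definition emb :: "'w graph \<Rightarrow> 'v graph \<Rightarrow> bool" where
  "emb H G \<longleftrightarrow> (\<exists>f. inj_on f (verts H) \<and> f ` verts H \<subseteq> verts G \<and>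
     (\<forall>u\<in>verts H. \<forall>v\<in>verts H. adjacent H u v \<longleftrightarrow> adjacent G (f u) (f v)))"

lemma embE:
  assumes "emb H G"
  obtains f where "inj_on f (verts H)" "f ` verts H \<subseteq> verts G"
    "\<And>u v. u \<in> verts H \<Longrightarrow> v \<in> verts H \<Longrightarrow> adjacent H u v \<longleftrightarrow> adjacent G (f u) (f v)"
  using assms unfolding emb_def by (elim exE conjE) (rule that; simp)

lemma emb_iff_induced: "emb H G \<longleftrightarrow> (\<exists>W\<subseteq>verts G. graph_iso (induced G W) H)"
proof
  assume "emb H G"
  then obtain f where f: "inj_on f (verts H)" "f ` verts H \<subseteq> verts G"
    and adj: "\<And>u v. u \<in> verts H \<Longrightarrow> v \<in> verts H \<Longrightarrow> adjacent H u v \<longleftrightarrow> adjacent G (f u) (f v)"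
    by (rule embE) blast
  let ?g = "inv_into (verts H) f"
  have "bij_betw ?g (f ` verts H) (verts H)"
    using f(1) by (simp add: bij_betw_inv_into inj_on_imp_bij_betw)
  moreover have "adjacent (induced G (f ` verts H)) x y \<longleftrightarrow> adjacent H (?g x) (?g y)"
    if "x \<in> f ` verts H" "y \<in> f ` verts H" for x y
    using that adj f(1) by (auto simp: adjacent_def induced_def)
  ultimately have "graph_iso (induced G (f ` verts H)) H"
    unfolding graph_iso_def by (intro exI[of _ ?g]) (simp add: induced_def)
  with f(2) show "\<exists>W\<subseteq>verts G. graph_iso (induced G W) H" by blast
next
  assume "\<exists>W\<subseteq>verts G. graph_iso (induced G W) H"
  then obtain W g where W: "W \<subseteq> verts G" and g: "bij_betw g W (verts H)"
    and adj: "\<And>u v. u \<in> W \<Longrightarrow> v \<in> W \<Longrightarrow> adjacent (induced G W) u v \<longleftrightarrow> adjacent H (g u) (g v)"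
    unfolding graph_iso_def by (auto simp: induced_def)
  let ?f = "inv_into W g"
  have f: "bij_betw ?f (verts H) W" using g by (rule bij_betw_inv_into)
  have "adjacent H u v \<longleftrightarrow> adjacent G (?f u) (?f v)"
    if "u \<in> verts H" "v \<in> verts H" for u v
  proof -
    have "?f u \<in> W" "?f v \<in> W" using f that by (auto simp: bij_betw_def)
    moreover have "g (?f u) = u" "g (?f v) = v" using g that by (auto simp: bij_betw_inv_into_right)
    ultimately show ?thesis
      using adj[of "?f u" "?f v"] by (auto simp: adjacent_def induced_def)
  qed
  then show "emb H G"
    unfolding emb_def using f W by (intro exI[of _ ?f]) (auto simp: bij_betw_def)
qed

lemma is_free_iff: "is_free \<F> G \<longleftrightarrow> (\<forall>H\<in>\<F>. \<not> emb H G)"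
  unfolding is_free_def emb_iff_induced by blast

lemma emb_trans:
  assumes "emb H K" "emb K G"
  shows "emb H G"
proof -
  obtain f where f: "inj_on f (verts H)" "f ` verts H \<subseteq> verts K"
      "\<And>u v. u \<in> verts H \<Longrightarrow> v \<in> verts H \<Longrightarrow> adjacent H u v \<longleftrightarrow> adjacent K (f u) (f v)"
    using assms(1) by (rule embE) blast
  obtain g where g: "inj_on g (verts K)" "g ` verts K \<subseteq> verts G"
      "\<And>u v. u \<in> verts K \<Longrightarrow> v \<in> verts K \<Longrightarrow> adjacent K u v \<longleftrightarrow> adjacent G (g u) (g v)"
    using assms(2) by (rule embE) blast
  have "inj_on (g \<circ> f) (verts H)"
    using f(1,2) g(1) by (meson comp_inj_on inj_on_subset)
  moreover have "(g \<circ> f) ` verts H \<subseteq> verts G" using f(2) g(2) by auto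
  ultimately show ?thesis
    unfolding emb_def using f g by (intro exI[of _ "g \<circ> f"]) (auto simp: image_subset_iff)
qed

lemma graph_iso_imp_emb: "graph_iso H G \<Longrightarrow> emb H G"
  unfolding graph_iso_def emb_def by (auto simp: bij_betw_def)

lemma emb_imp_graph_iso:
  assumes "emb K H" "finite (verts H)" "card (verts H) = card (verts K)"
  shows "graph_iso H K"
proof -
  obtain W where W: "W \<subseteq> verts H" "graph_iso (induced H W) K"
    using assms(1) unfolding emb_iff_induced by blast
  then have "card W = card (verts K)"
    unfolding graph_iso_def by (auto simp: induced_def dest: bij_betw_same_card)
  with W(1) assms have "W = verts H" by (metis card_subset_eq)
  with W(2) show ?thesis unfolding graph_iso_def by (auto simp: induced_def adjacent_def)
qed

lemma family_leI: "(\<And>H. H \<in> \<F>' \<Longrightarrow> \<exists>K\<in>\<F>. emb K H) \<Longrightarrow> \<F> \<unlhd> \<F>'"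
  unfolding family_le_def is_free_iff by (meson emb_trans)

text \<open>
  This turns containment of a concrete four-vertex graph into a statement about four vertices and
  six adjacencies.
\<close>

lemma emb_four:
  fixes X :: "'w graph" and G :: "'v graph"
  assumes V: "verts X = {w, x, y, z}" and d: "distinct [w, x, y, z]"
    and "simple_graph X" "simple_graph G"
  shows "emb X G \<longleftrightarrow> (\<exists>a b c d. {a, b, c, d} \<subseteq> verts G \<and> distinct [a, b, c, d] \<and>
     (adjacent G a b \<longleftrightarrow> adjacent X w x) \<and> (adjacent G a c \<longleftrightarrow> adjacent X w y) \<and>
     (adjacent G a d \<longleftrightarrow> adjacent X w z) \<and> (adjacent G b c \<longleftrightarrow> adjacent X x y) \<and>
     (adjacent G b d \<longleftrightarrow> adjacent X x z) \<and> (adjacent G c d \<longleftrightarrow> adjacent X y z))" (is "_ \<longleftrightarrow> ?R")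
proof
  assume "emb X G"
  then obtain f where f: "inj_on f (verts X)" "f ` verts X \<subseteq> verts G"
      "\<And>u v. u \<in> verts X \<Longrightarrow> v \<in> verts X \<Longrightarrow> adjacent X u v \<longleftrightarrow> adjacent G (f u) (f v)"
    by (rule embE) blast
  have "distinct [f w, f x, f y, f z]"
    using d inj_on_eq_iff[OF f(1)] unfolding V by simp
  moreover have "{f w, f x, f y, f z} \<subseteq> verts G" using f(2) unfolding V by simp
  moreover note f(3)[of w x] f(3)[of w y] f(3)[of w z] f(3)[of x y] f(3)[of x z] f(3)[of y z]
  ultimately show ?R unfolding V
    by (intro exI[of _ "f w"] exI[of _ "f x"] exI[of _ "f y"] exI[of _ "f z"]) simp
next
  assume ?R
  then obtain a b c e where *: "{a, b, c, e} \<subseteq> verts G" "distinct [a, b, c, e]"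
     "adjacent G a b \<longleftrightarrow> adjacent X w x" "adjacent G a c \<longleftrightarrow> adjacent X w y"
     "adjacent G a e \<longleftrightarrow> adjacent X w z" "adjacent G b c \<longleftrightarrow> adjacent X x y"
     "adjacent G b e \<longleftrightarrow> adjacent X x z" "adjacent G c e \<longleftrightarrow> adjacent X y z"
    by (elim exE conjE) (rule that; assumption)
  note irr = adjacent_irrefl[OF assms(3)] adjacent_irrefl[OF assms(4)]
  let ?f = "(\<lambda>_. e)(w := a, x := b, y := c)"
  have f: "?f w = a" "?f x = b" "?f y = c" "?f z = e" using d by auto
  show "emb X G" unfolding emb_def V
  proof (intro exI[of _ ?f] conjI)
    show "inj_on ?f {w, x, y, z}" using *(2) d by (auto simp: inj_on_def)
    show "?f ` {w, x, y, z} \<subseteq> verts G" using *(1) by auto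
    show "\<forall>u\<in>{w, x, y, z}. \<forall>v\<in>{w, x, y, z}. adjacent X u v \<longleftrightarrow> adjacent G (?f u) (?f v)"
      using *(3-) irr by (simp add: f adjacent_commute[of X x w] adjacent_commute[of X y w]
        adjacent_commute[of X z w] adjacent_commute[of X y x] adjacent_commute[of X z x]
        adjacent_commute[of X z y] adjacent_commute[of G b a] adjacent_commute[of G c a]
        adjacent_commute[of G e a] adjacent_commute[of G c b] adjacent_commute[of G e b]
        adjacent_commute[of G e c] del: fun_upd_apply)
  qed
qed

section \<open>The graphs on at most four vertices\<close>

text \<open>
  The small graphs are brought into the form of explicit vertex and edge sets, so that adjacency
  in them is decided by rewriting.
\<close>

lemma path_graph_Suc:
  "path_graph (Suc 0) = \<lparr>verts = {0}, edges = {}\<rparr>"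
  "path_graph (Suc (Suc n)) = \<lparr>verts = insert (Suc n) (verts (path_graph (Suc n))),
     edges = insert {n, Suc n} (edges (path_graph (Suc n)))\<rparr>"
  by (auto simp: path_graph_def less_Suc_eq)

lemma complete_graph_Suc:
  "complete_graph 0 = \<lparr>verts = {}, edges = {}\<rparr>"
  "complete_graph (Suc n) = \<lparr>verts = insert n (verts (complete_graph n)),
     edges = (\<lambda>i. {i, n}) ` verts (complete_graph n) \<union> edges (complete_graph n)\<rparr>"
  by (auto simp: complete_graph_def less_Suc_eq)




abbreviation (input) "P4 \<equiv> path_graph 4"
abbreviation (input) "TwoP2 \<equiv> copies 2 (path_graph 2)"
abbreviation (input) "FourP1 \<equiv> copies 4 (path_graph 1)"
abbreviation (input) "P2_2P1 \<equiv> path_graph 2 \<oplus> copies 2 (path_graph 1)"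
abbreviation (input) "P3_P1 \<equiv> path_graph 3 \<oplus> path_graph 1"
abbreviation (input) "K3_P1 \<equiv> complete_graph 3 \<oplus> path_graph 1"
abbreviation (input) "K4 \<equiv> complete_graph 4"
abbreviation (input) "C4 \<equiv> cycle_graph 4"

lemma small_graphs:
  "P4 = \<lparr>verts = {0, 1, 2, 3}, edges = {{0, 1}, {1, 2}, {2, 3}}\<rparr>"
  "TwoP2 = \<lparr>verts = {0, 2, 1, 5}, edges = {{0, 2}, {1, 5}}\<rparr>"
  "FourP1 = \<lparr>verts = {0, 1, 3, 7}, edges = {}\<rparr>"
  "P2_2P1 = \<lparr>verts = {0, 2, 1, 3}, edges = {{0, 2}}\<rparr>"
  "P3_P1 = \<lparr>verts = {0, 2, 4, 1}, edges = {{0, 2}, {2, 4}}\<rparr>"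
  "K3_P1 = \<lparr>verts = {0, 2, 4, 1}, edges = {{0, 2}, {0, 4}, {2, 4}}\<rparr>"
  "K4 = \<lparr>verts = {0, 1, 2, 3},
     edges = {{0, 1}, {0, 2}, {0, 3}, {1, 2}, {1, 3}, {2, 3}}\<rparr>"
  by (simp_all add: path_graph_Suc complete_graph_Suc disj_union_def map_graph_def
      Let_def eval_nat_numeral insert_commute)

lemma cycle_graph_4:
  "C4 = \<lparr>verts = {0, 1, 2, 3}, edges = {{0, 1}, {1, 2}, {2, 3}, {0, 3}}\<rparr>"
proof -
  have V: "{..<4} = {0, 1, 2, 3 :: nat}" by auto
  have "{{i, Suc i mod 4} |i. i < 4} = (\<lambda>i. {i, Suc i mod 4}) ` {..<4}"
    by (simp add: setcompr_eq_image lessThan_def)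
  also have "\<dots> = {{0, 1}, {1, 2}, {2, 3}, {0, 3}}" by (simp add: V insert_commute) (simp add: eval_nat_numeral insert_commute)
  finally show ?thesis by (simp add: cycle_graph_def V)
qed

lemma claw_explicit:
  "claw = \<lparr>verts = {0, 1, 2, 3}, edges = {{0, 1}, {0, 2}, {0, 3}}\<rparr>"
proof -
  have "{{i, j} |i j. i < 1 \<and> 1 \<le> j \<and> j < 1 + 3} = (\<lambda>j. {0, j}) ` {1..<4 :: nat}"
    by (auto simp: image_def)
  moreover have "{1..<4} = {1, 2, 3 :: nat}" "{..<4} = {0, 1, 2, 3 :: nat}" by auto
  ultimately show ?thesis by (simp add: claw_def complete_bipartite_def)
qed

lemma diamond_explicit:
  "diamond = \<lparr>verts = {0, 1, 2, 3}, edges = {{0, 2}, {0, 3}, {1, 2}, {1, 3}, {2, 3}}\<rparr>"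
  by (simp add: diamond_def small_graphs insert_Diff_if doubleton_eq_iff)

lemmas explicit_graphs = small_graphs cycle_graph_4 claw_explicit diamond_explicit paw_def

lemma adjacent_explicit: "adjacent \<lparr>verts = V, edges = E\<rparr> u v \<longleftrightarrow> {u, v} \<in> E"
  by (simp add: adjacent_def)

lemma simple_small_graphs:
  "simple_graph P4" "simple_graph TwoP2" "simple_graph FourP1" "simple_graph P2_2P1"
  "simple_graph P3_P1" "simple_graph K3_P1" "simple_graph K4" "simple_graph C4"
  "simple_graph claw" "simple_graph diamond" "simple_graph paw"
  unfolding explicit_graphs by (simp_all add: simple_graph_def)

lemma card_small_graphs:
  "card (verts P4) = 4" "card (verts TwoP2) = 4" "card (verts FourP1) = 4" "card (verts P2_2P1) = 4"
  "card (verts P3_P1) = 4" "card (verts K3_P1) = 4" "card (verts K4) = 4" "card (verts C4) = 4"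
  "card (verts claw) = 4" "card (verts diamond) = 4" "card (verts paw) = 4"
  unfolding explicit_graphs by simp_all

lemma emb_P4:
  assumes "simple_graph G"
  shows "emb P4 G \<longleftrightarrow> (\<exists>a b c d. {a, b, c, d} \<subseteq> verts G \<and> distinct [a, b, c, d] \<and>
    adjacent G a b \<and> \<not> adjacent G a c \<and> \<not> adjacent G a d \<and>
    adjacent G b c \<and> \<not> adjacent G b d \<and> adjacent G c d)"
  using emb_four[of P4 0 1 2 3 G] assms simple_small_graphs
  unfolding explicit_graphs by (simp add: adjacent_explicit doubleton_eq_iff)

lemma emb_P4I:
  assumes "simple_graph G" "{a, b, c, d} \<subseteq> verts G" "distinct [a, b, c, d]"
    "adjacent G a b" "\<not> adjacent G a c" "\<not> adjacent G a d"
    "adjacent G b c" "\<not> adjacent G b d" "adjacent G c d"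
  shows "emb P4 G"
  unfolding emb_P4[OF assms(1)] using assms(2-) by (intro exI conjI)

lemma emb_TwoP2:
  assumes "simple_graph G"
  shows "emb TwoP2 G \<longleftrightarrow> (\<exists>a b c d. {a, b, c, d} \<subseteq> verts G \<and> distinct [a, b, c, d] \<and>
    adjacent G a b \<and> \<not> adjacent G a c \<and> \<not> adjacent G a d \<and>
    \<not> adjacent G b c \<and> \<not> adjacent G b d \<and> adjacent G c d)"
  using emb_four[of TwoP2 0 2 1 5 G] assms simple_small_graphs
  unfolding explicit_graphs by (simp add: adjacent_explicit doubleton_eq_iff)

lemma emb_TwoP2I:
  assumes "simple_graph G" "{a, b, c, d} \<subseteq> verts G" "distinct [a, b, c, d]"
    "adjacent G a b" "\<not> adjacent G a c" "\<not> adjacent G a d"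
    "\<not> adjacent G b c" "\<not> adjacent G b d" "adjacent G c d"
  shows "emb TwoP2 G"
  unfolding emb_TwoP2[OF assms(1)] using assms(2-) by (intro exI conjI)

lemma emb_FourP1:
  assumes "simple_graph G"
  shows "emb FourP1 G \<longleftrightarrow> (\<exists>a b c d. {a, b, c, d} \<subseteq> verts G \<and> distinct [a, b, c, d] \<and>
    \<not> adjacent G a b \<and> \<not> adjacent G a c \<and> \<not> adjacent G a d \<and>
    \<not> adjacent G b c \<and> \<not> adjacent G b d \<and> \<not> adjacent G c d)"
  using emb_four[of FourP1 0 1 3 7 G] assms simple_small_graphs
  unfolding explicit_graphs by (simp add: adjacent_explicit doubleton_eq_iff)

lemma emb_FourP1I:
  assumes "simple_graph G" "{a, b, c, d} \<subseteq> verts G" "distinct [a, b, c, d]"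
    "\<not> adjacent G a b" "\<not> adjacent G a c" "\<not> adjacent G a d"
    "\<not> adjacent G b c" "\<not> adjacent G b d" "\<not> adjacent G c d"
  shows "emb FourP1 G"
  unfolding emb_FourP1[OF assms(1)] using assms(2-) by (intro exI conjI)

lemma emb_P2_2P1:
  assumes "simple_graph G"
  shows "emb P2_2P1 G \<longleftrightarrow> (\<exists>a b c d. {a, b, c, d} \<subseteq> verts G \<and> distinct [a, b, c, d] \<and>
    adjacent G a b \<and> \<not> adjacent G a c \<and> \<not> adjacent G a d \<and>
    \<not> adjacent G b c \<and> \<not> adjacent G b d \<and> \<not> adjacent G c d)"
  using emb_four[of P2_2P1 0 2 1 3 G] assms simple_small_graphs
  unfolding explicit_graphs by (simp add: adjacent_explicit doubleton_eq_iff)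

lemma emb_P2_2P1I:
  assumes "simple_graph G" "{a, b, c, d} \<subseteq> verts G" "distinct [a, b, c, d]"
    "adjacent G a b" "\<not> adjacent G a c" "\<not> adjacent G a d"
    "\<not> adjacent G b c" "\<not> adjacent G b d" "\<not> adjacent G c d"
  shows "emb P2_2P1 G"
  unfolding emb_P2_2P1[OF assms(1)] using assms(2-) by (intro exI conjI)

lemma emb_P3_P1:
  assumes "simple_graph G"
  shows "emb P3_P1 G \<longleftrightarrow> (\<exists>a b c d. {a, b, c, d} \<subseteq> verts G \<and> distinct [a, b, c, d] \<and>
    adjacent G a b \<and> \<not> adjacent G a c \<and> \<not> adjacent G a d \<and>
    adjacent G b c \<and> \<not> adjacent G b d \<and> \<not> adjacent G c d)"
  using emb_four[of P3_P1 0 2 4 1 G] assms simple_small_graphs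
  unfolding explicit_graphs by (simp add: adjacent_explicit doubleton_eq_iff)

lemma emb_P3_P1I:
  assumes "simple_graph G" "{a, b, c, d} \<subseteq> verts G" "distinct [a, b, c, d]"
    "adjacent G a b" "\<not> adjacent G a c" "\<not> adjacent G a d"
    "adjacent G b c" "\<not> adjacent G b d" "\<not> adjacent G c d"
  shows "emb P3_P1 G"
  unfolding emb_P3_P1[OF assms(1)] using assms(2-) by (intro exI conjI)

lemma emb_K3_P1:
  assumes "simple_graph G"
  shows "emb K3_P1 G \<longleftrightarrow> (\<exists>a b c d. {a, b, c, d} \<subseteq> verts G \<and> distinct [a, b, c, d] \<and>
    adjacent G a b \<and> adjacent G a c \<and> \<not> adjacent G a d \<and>
    adjacent G b c \<and> \<not> adjacent G b d \<and> \<not> adjacent G c d)"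
  using emb_four[of K3_P1 0 2 4 1 G] assms simple_small_graphs
  unfolding explicit_graphs by (simp add: adjacent_explicit doubleton_eq_iff)

lemma emb_K3_P1I:
  assumes "simple_graph G" "{a, b, c, d} \<subseteq> verts G" "distinct [a, b, c, d]"
    "adjacent G a b" "adjacent G a c" "\<not> adjacent G a d"
    "adjacent G b c" "\<not> adjacent G b d" "\<not> adjacent G c d"
  shows "emb K3_P1 G"
  unfolding emb_K3_P1[OF assms(1)] using assms(2-) by (intro exI conjI)

lemma emb_K4:
  assumes "simple_graph G"
  shows "emb K4 G \<longleftrightarrow> (\<exists>a b c d. {a, b, c, d} \<subseteq> verts G \<and> distinct [a, b, c, d] \<and>
    adjacent G a b \<and> adjacent G a c \<and> adjacent G a d \<and>
    adjacent G b c \<and> adjacent G b d \<and> adjacent G c d)"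
  using emb_four[of K4 0 1 2 3 G] assms simple_small_graphs
  unfolding explicit_graphs by (simp add: adjacent_explicit doubleton_eq_iff)

lemma emb_K4I:
  assumes "simple_graph G" "{a, b, c, d} \<subseteq> verts G" "distinct [a, b, c, d]"
    "adjacent G a b" "adjacent G a c" "adjacent G a d"
    "adjacent G b c" "adjacent G b d" "adjacent G c d"
  shows "emb K4 G"
  unfolding emb_K4[OF assms(1)] using assms(2-) by (intro exI conjI)

lemma emb_C4:
  assumes "simple_graph G"
  shows "emb C4 G \<longleftrightarrow> (\<exists>a b c d. {a, b, c, d} \<subseteq> verts G \<and> distinct [a, b, c, d] \<and>
    adjacent G a b \<and> \<not> adjacent G a c \<and> adjacent G a d \<and>
    adjacent G b c \<and> \<not> adjacent G b d \<and> adjacent G c d)"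
  using emb_four[of C4 0 1 2 3 G] assms simple_small_graphs
  unfolding explicit_graphs by (simp add: adjacent_explicit doubleton_eq_iff)

lemma emb_C4I:
  assumes "simple_graph G" "{a, b, c, d} \<subseteq> verts G" "distinct [a, b, c, d]"
    "adjacent G a b" "\<not> adjacent G a c" "adjacent G a d"
    "adjacent G b c" "\<not> adjacent G b d" "adjacent G c d"
  shows "emb C4 G"
  unfolding emb_C4[OF assms(1)] using assms(2-) by (intro exI conjI)

lemma emb_claw:
  assumes "simple_graph G"
  shows "emb claw G \<longleftrightarrow> (\<exists>a b c d. {a, b, c, d} \<subseteq> verts G \<and> distinct [a, b, c, d] \<and>
    adjacent G a b \<and> adjacent G a c \<and> adjacent G a d \<and>
    \<not> adjacent G b c \<and> \<not> adjacent G b d \<and> \<not> adjacent G c d)"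
  using emb_four[of claw 0 1 2 3 G] assms simple_small_graphs
  unfolding explicit_graphs by (simp add: adjacent_explicit doubleton_eq_iff)

lemma emb_clawI:
  assumes "simple_graph G" "{a, b, c, d} \<subseteq> verts G" "distinct [a, b, c, d]"
    "adjacent G a b" "adjacent G a c" "adjacent G a d"
    "\<not> adjacent G b c" "\<not> adjacent G b d" "\<not> adjacent G c d"
  shows "emb claw G"
  unfolding emb_claw[OF assms(1)] using assms(2-) by (intro exI conjI)

lemma emb_diamond:
  assumes "simple_graph G"
  shows "emb diamond G \<longleftrightarrow> (\<exists>a b c d. {a, b, c, d} \<subseteq> verts G \<and> distinct [a, b, c, d] \<and>
    \<not> adjacent G a b \<and> adjacent G a c \<and> adjacent G a d \<and>
    adjacent G b c \<and> adjacent G b d \<and> adjacent G c d)"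
  using emb_four[of diamond 0 1 2 3 G] assms simple_small_graphs
  unfolding explicit_graphs by (simp add: adjacent_explicit doubleton_eq_iff)

lemma emb_diamondI:
  assumes "simple_graph G" "{a, b, c, d} \<subseteq> verts G" "distinct [a, b, c, d]"
    "\<not> adjacent G a b" "adjacent G a c" "adjacent G a d"
    "adjacent G b c" "adjacent G b d" "adjacent G c d"
  shows "emb diamond G"
  unfolding emb_diamond[OF assms(1)] using assms(2-) by (intro exI conjI)

lemma emb_paw:
  assumes "simple_graph G"
  shows "emb paw G \<longleftrightarrow> (\<exists>a b c d. {a, b, c, d} \<subseteq> verts G \<and> distinct [a, b, c, d] \<and>
    adjacent G a b \<and> adjacent G a c \<and> adjacent G a d \<and>
    adjacent G b c \<and> \<not> adjacent G b d \<and> \<not> adjacent G c d)"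
  using emb_four[of paw 0 1 2 3 G] assms simple_small_graphs
  unfolding explicit_graphs by (simp add: adjacent_explicit doubleton_eq_iff)

lemma emb_pawI:
  assumes "simple_graph G" "{a, b, c, d} \<subseteq> verts G" "distinct [a, b, c, d]"
    "adjacent G a b" "adjacent G a c" "adjacent G a d"
    "adjacent G b c" "\<not> adjacent G b d" "\<not> adjacent G c d"
  shows "emb paw G"
  unfolding emb_paw[OF assms(1)] using assms(2-) by (intro exI conjI)

definition has_triangle :: "'v graph \<Rightarrow> bool" where
  "has_triangle G \<longleftrightarrow> (\<exists>a b c. adjacent G a b \<and> adjacent G a c \<and> adjacent G b c)"

definition has_cotriangle :: "'v graph \<Rightarrow> bool" where
  "has_cotriangle G \<longleftrightarrow> (\<exists>a b c. {a, b, c} \<subseteq> verts G \<and> distinct [a, b, c] \<and>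
     \<not> adjacent G a b \<and> \<not> adjacent G a c \<and> \<not> adjacent G b c)"

lemma emb_threeI:
  assumes "verts X = {x, y, z}" and "distinct [x, y, z]" and "simple_graph X" "simple_graph G"
    and "{a, b, c} \<subseteq> verts G" "distinct [a, b, c]"
    and "adjacent X x y \<longleftrightarrow> adjacent G a b" "adjacent X x z \<longleftrightarrow> adjacent G a c"
    and "adjacent X y z \<longleftrightarrow> adjacent G b c"
  shows "emb X G"
proof -
  let ?f = "(\<lambda>_. c)(x := a, y := b)"
  have f: "?f x = a" "?f y = b" "?f z = c" using assms(2) by auto
  show ?thesis unfolding emb_def assms(1)
  proof (intro exI[of _ ?f] conjI)
    show "inj_on ?f {x, y, z}" using assms(2,6) by (auto simp: inj_on_def)
    show "?f ` {x, y, z} \<subseteq> verts G" using assms(5) by auto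
    show "\<forall>u\<in>{x, y, z}. \<forall>v\<in>{x, y, z}. adjacent X u v \<longleftrightarrow> adjacent G (?f u) (?f v)"
      using assms(7-) adjacent_irrefl[OF assms(3)] adjacent_irrefl[OF assms(4)]
      by (simp add: f adjacent_commute[of X y x] adjacent_commute[of X z x]
          adjacent_commute[of X z y] adjacent_commute[of G b a] adjacent_commute[of G c a]
          adjacent_commute[of G c b] del: fun_upd_apply)
  qed
qed

text \<open>
  Apart from the triangle and three isolated vertices, every graph on at most three vertices is an
  induced subgraph of P4.
\<close>

lemma emb_at_most_three:
  assumes H: "simple_graph H" and "card (verts H) \<le> 3"
  shows "emb H P4 \<or> has_cotriangle H \<and> emb H P3_P1 \<or> has_triangle H \<and> emb H paw"
proof -
  have P4: "{0, 1, 2, 3} \<subseteq> verts P4" "adjacent P4 0 1" "adjacent P4 1 2" "\<not> adjacent P4 0 2"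
    "\<not> adjacent P4 0 3" "\<not> adjacent P4 1 3"
    unfolding explicit_graphs by (simp_all add: adjacent_explicit doubleton_eq_iff)
  note P4_irrefl = adjacent_irrefl[OF simple_small_graphs(1)]
  have "finite (verts H)" "verts H \<noteq> {}" using H by (auto simp: simple_graph_def)
  then have "card (verts H) = Suc 0 \<or> card (verts H) = 2 \<or> card (verts H) = 3"
    using assms(2) by (metis card_gt_0_iff le_Suc_eq not_less_eq_eq numeral_2_eq_2 numeral_3_eq_3
        le_zero_eq not_gr_zero)
  then consider x where "verts H = {x}" | x y where "verts H = {x, y}" "x \<noteq> y"
    | x y z where "verts H = {x, y, z}" "distinct [x, y, z]"
    using that by (auto simp: card_2_iff card_3_iff card_1_singleton_iff)
  then show ?thesis
  proof cases
    case 1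
    then have "emb H P4" unfolding emb_def
      using P4 P4_irrefl adjacent_irrefl[OF H] by (intro exI[of _ "\<lambda>_. 0"]) auto
    then show ?thesis by simp
  next
    case 2
    let ?f = "\<lambda>v. if v = x then 0 else if adjacent H x y then 1 else 2 :: nat"
    have "emb H P4" unfolding emb_def
      using 2 P4 P4_irrefl adjacent_irrefl[OF H] adjacent_commute[of P4] adjacent_commute[of H x y]
      by (intro exI[of _ ?f]) (auto simp: inj_on_def)
    then show ?thesis by simp
  next
    case 3
    note P4I = emb_threeI[OF _ _ H simple_small_graphs(1)]
    note comm = adjacent_commute[of P4 1 0] adjacent_commute[of P4 2 1] adjacent_commute[of P4 2 0]
      adjacent_commute[of P4 3 0] adjacent_commute[of P4 3 1]
      adjacent_commute[of H y x] adjacent_commute[of H z x] adjacent_commute[of H z y]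
    have perm: "verts H = {y, z, x}" "verts H = {x, z, y}" "verts H = {y, x, z}" using 3 by auto
    consider "\<not> adjacent H x y" "\<not> adjacent H x z" "\<not> adjacent H y z"
      | "adjacent H x y" "adjacent H x z" "adjacent H y z"
      | "adjacent H x y" "\<not> adjacent H x z" "\<not> adjacent H y z"
      | "\<not> adjacent H x y" "adjacent H x z" "\<not> adjacent H y z"
      | "\<not> adjacent H x y" "\<not> adjacent H x z" "adjacent H y z"
      | "adjacent H x y" "adjacent H x z" "\<not> adjacent H y z"
      | "adjacent H x y" "\<not> adjacent H x z" "adjacent H y z"
      | "\<not> adjacent H x y" "adjacent H x z" "adjacent H y z" by blast
    then show ?thesis
    proof cases
      case 1
      have "has_cotriangle H" unfolding has_cotriangle_def using 1 3
        by (intro exI[of _ x] exI[of _ y] exI[of _ z]) simp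
      moreover have "{0, 4, 1} \<subseteq> verts P3_P1" "\<not> adjacent P3_P1 0 4" "\<not> adjacent P3_P1 0 1"
        "\<not> adjacent P3_P1 4 1"
        unfolding explicit_graphs by (simp_all add: adjacent_explicit doubleton_eq_iff)
      with 1 3 have "emb H P3_P1"
        by (intro emb_threeI[OF 3 H simple_small_graphs(5), of 0 4 1]) simp_all
      ultimately show ?thesis by simp
    next
      case 2
      then have "has_triangle H" unfolding has_triangle_def by blast
      moreover have "{0, 1, 2} \<subseteq> verts paw" "adjacent paw 0 1" "adjacent paw 0 2"
        "adjacent paw 1 2"
        unfolding explicit_graphs by (simp_all add: adjacent_explicit doubleton_eq_iff)
      with 2 3 have "emb H paw"
        by (intro emb_threeI[OF 3 H simple_small_graphs(11), of 0 1 2]) simp_all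
      ultimately show ?thesis by simp
    next
      case 3
      then show ?thesis using P4 \<open>distinct _\<close>
        by (intro disjI1 P4I[OF \<open>verts H = {x, y, z}\<close>, of 0 1 3]) (auto simp: comm)
    next
      case 4
      then show ?thesis using P4 \<open>distinct _\<close>
        by (intro disjI1 P4I[OF \<open>verts H = {x, z, y}\<close>, of 0 1 3]) (auto simp: comm)
    next
      case 5
      then show ?thesis using P4 \<open>distinct _\<close>
        by (intro disjI1 P4I[OF \<open>verts H = {y, z, x}\<close>, of 0 1 3]) (auto simp: comm)
    next
      case 6
      then show ?thesis using P4 \<open>distinct _\<close>
        by (intro disjI1 P4I[OF \<open>verts H = {y, x, z}\<close>, of 0 1 2]) (auto simp: comm)
    next
      case 7
      then show ?thesis using P4 \<open>distinct _\<close>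
        by (intro disjI1 P4I[OF \<open>verts H = {x, y, z}\<close>, of 0 1 2]) (auto simp: comm)
    next
      case 8
      then show ?thesis using P4 \<open>distinct _\<close>
        by (intro disjI1 P4I[OF \<open>verts H = {x, z, y}\<close>, of 0 1 2]) (auto simp: comm)
    qed
  qed
qed

text \<open>
  The fourth vertex has between zero and three neighbours among three independent ones, and only
  their number matters.  The next lemma is the complementary case.
\<close>

lemma emb_if_cotriangle:
  assumes H: "simple_graph H" and "card (verts H) = 4" and "has_cotriangle H"
  shows "emb FourP1 H \<or> emb P2_2P1 H \<or> emb P3_P1 H \<or> emb claw H"
proof -
  obtain a b c where abc: "{a, b, c} \<subseteq> verts H" "distinct [a, b, c]"
    "\<not> adjacent H a b" "\<not> adjacent H a c" "\<not> adjacent H b c"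
    using assms(3) unfolding has_cotriangle_def by blast
  have "card {a, b, c} = 3" using abc(2) by simp
  then have "\<not> verts H \<subseteq> {a, b, c}"
    using assms(2) card_mono[of "{a, b, c}" "verts H"] by auto
  then obtain d where d: "d \<in> verts H" "d \<notin> {a, b, c}" by blast
  have pair: "\<not> adjacent H b a" "\<not> adjacent H c a" "\<not> adjacent H c b"
    using abc(3-5) by (simp_all add: adjacent_commute)
  have one: "emb P2_2P1 H" if "adjacent H d x" "\<not> adjacent H d y" "\<not> adjacent H d z"
      "{x, y, z} \<subseteq> verts H" "distinct [d, x, y, z]"
      "\<not> adjacent H x y" "\<not> adjacent H x z" "\<not> adjacent H y z" for x y z
    unfolding emb_P2_2P1[OF H] using that d(1)
    by (intro exI[of _ d] exI[of _ x] exI[of _ y] exI[of _ z]) simp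
  have two: "emb P3_P1 H" if "adjacent H d x" "adjacent H d y" "\<not> adjacent H d z"
      "{x, y, z} \<subseteq> verts H" "distinct [d, x, y, z]"
      "\<not> adjacent H x y" "\<not> adjacent H x z" "\<not> adjacent H y z" for x y z
    unfolding emb_P3_P1[OF H] using that d(1) adjacent_sym[OF that(1)]
    by (intro exI[of _ x] exI[of _ d] exI[of _ y] exI[of _ z]) auto
  have three: "emb claw H" if "adjacent H d a" "adjacent H d b" "adjacent H d c"
    unfolding emb_claw[OF H] using that abc d
    by (intro exI[of _ d] exI[of _ a] exI[of _ b] exI[of _ c]) simp
  have none: "emb FourP1 H" if "\<not> adjacent H d a" "\<not> adjacent H d b" "\<not> adjacent H d c"
    unfolding emb_FourP1[OF H] using that abc d
    by (intro exI[of _ d] exI[of _ a] exI[of _ b] exI[of _ c]) simp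
  show ?thesis
    using none three one[of a b c] one[of b a c] one[of c a b] two[of a b c] two[of a c b] two[of b c a]
      abc pair d by simp blast
qed

lemma emb_if_triangle:
  assumes H: "simple_graph H" and "card (verts H) = 4" and "has_triangle H"
  shows "emb K3_P1 H \<or> emb paw H \<or> emb diamond H \<or> emb K4 H"
proof -
  obtain a b c where adj: "adjacent H a b" "adjacent H a c" "adjacent H b c"
    using assms(3) unfolding has_triangle_def by blast
  have abc: "{a, b, c} \<subseteq> verts H" "distinct [a, b, c]"
    using adj adjacent_verts[OF H] by auto
  have "card {a, b, c} = 3" using abc(2) by simp
  then have "\<not> verts H \<subseteq> {a, b, c}"
    using assms(2) card_mono[of "{a, b, c}" "verts H"] by auto
  then obtain d where d: "d \<in> verts H" "d \<notin> {a, b, c}" by blast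
  have pair: "adjacent H b a" "adjacent H c a" "adjacent H c b"
    using adj by (simp_all add: adjacent_commute)
  have one: "emb paw H" if "adjacent H x d" "\<not> adjacent H y d" "\<not> adjacent H z d"
      "{x, y, z} \<subseteq> verts H" "distinct [d, x, y, z]"
      "adjacent H x y" "adjacent H x z" "adjacent H y z" for x y z
    unfolding emb_paw[OF H] using that d(1)
    by (intro exI[of _ x] exI[of _ y] exI[of _ z] exI[of _ d]) auto
  have two: "emb diamond H" if "adjacent H x d" "adjacent H y d" "\<not> adjacent H z d"
      "{x, y, z} \<subseteq> verts H" "distinct [d, x, y, z]"
      "adjacent H x y" "adjacent H x z" "adjacent H y z" for x y z
    unfolding emb_diamond[OF H] using that d(1) that(1,2,7,8)[THEN adjacent_sym]
    by (intro exI[of _ z] exI[of _ d] exI[of _ x] exI[of _ y]) auto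
  have three: "emb K4 H" if "adjacent H a d" "adjacent H b d" "adjacent H c d"
    unfolding emb_K4[OF H] using that abc d adj
    by (intro exI[of _ a] exI[of _ b] exI[of _ c] exI[of _ d]) auto
  have none: "emb K3_P1 H" if "\<not> adjacent H a d" "\<not> adjacent H b d" "\<not> adjacent H c d"
    unfolding emb_K3_P1[OF H] using that abc d adj
    by (intro exI[of _ a] exI[of _ b] exI[of _ c] exI[of _ d]) auto
  show ?thesis
    using none three one[of a b c] one[of b a c] one[of c a b] two[of a b c] two[of a c b] two[of b c a]
      abc pair d adj by simp blast
qed

text \<open>
  Four vertices without a triangle and without three independent vertices carry two disjoint edges,
  and the edges between these two form a matching of size zero, one or two.
\<close>

lemma emb_if_Ramsey:
  assumes H: "simple_graph H" and "card (verts H) = 4"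
    and tri: "\<not> has_triangle H" and cotri: "\<not> has_cotriangle H"
  shows "emb P4 H \<or> emb TwoP2 H \<or> emb C4 H"
proof -
  have tri: "\<not> adjacent H b c" if "adjacent H a b" "adjacent H a c" for a b c
    using that tri unfolding has_triangle_def by blast
  have cotri: "adjacent H b c" if "\<not> adjacent H a b" "\<not> adjacent H a c" 
      "a \<in> verts H" "b \<in> verts H" "c \<in> verts H" "distinct [a, b, c]" for a b c
    using that cotri unfolding has_cotriangle_def by simp blast
  note comm = adjacent_commute[of H]
  obtain a b c d where "verts H = {a, b, c, d}" and "distinct [a, b, c, d]"
  proof -
    obtain B a where "verts H = insert a B" "a \<notin> B" "card B = 3"
      using assms(2) card_eq_SucD[of "verts H" 3] by auto
    then obtain x y z where "B = {x, y, z}" "x \<noteq> y" "y \<noteq> z" "x \<noteq> z" by (auto simp: card_3_iff)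
    then show thesis using \<open>verts H = _\<close> \<open>a \<notin> B\<close> that[of a x y z] by simp
  qed
  note V = this
  have "\<exists>w x y z. {w, x, y, z} \<subseteq> verts H \<and> distinct [w, x, y, z] \<and> adjacent H w x \<and> adjacent H y z"
  proof (rule ccontr)
    assume no: "\<not> ?thesis"
    have pm: "\<not> adjacent H y z" if "adjacent H w x" "{w, x, y, z} \<subseteq> verts H" "distinct [w, x, y, z]" for w x y z
      using no that by blast
    have *: False if "{w, x, y, z} \<subseteq> verts H" "distinct [w, x, y, z]" "adjacent H w x" for w x y z
      using pm[of w x y z] pm[of w y x z] pm[of w z x y] cotri[of w y z] cotri[of x y z] tri[of w x y] tri[of w x z]
        that by auto
    show False using *[of a b c d] *[of a c b d] *[of b c a d] cotri[of a b c] V by auto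
  qed
  then obtain w x y z where *: "{w, x, y, z} \<subseteq> verts H" "distinct [w, x, y, z]"
    "adjacent H w x" "adjacent H y z" by (elim exE conjE) (rule that; assumption)
  have one: "emb P4 H" if "{w, x, y, z} \<subseteq> verts H" "distinct [w, x, y, z]"
    "adjacent H w x" "adjacent H y z" "adjacent H x y" "\<not> adjacent H w z" for w x y z
    unfolding emb_P4[OF H] using that tri[of x w y] tri[of y x z] comm
    by (intro exI[of _ w] exI[of _ x] exI[of _ y] exI[of _ z]) simp
  have two: "emb C4 H" if "{w, x, y, z} \<subseteq> verts H" "distinct [w, x, y, z]"
    "adjacent H w x" "adjacent H y z" "adjacent H x y" "adjacent H w z" for w x y z
    unfolding emb_C4[OF H] using that tri[of x w y] tri[of y x z] comm
    by (intro exI[of _ w] exI[of _ x] exI[of _ y] exI[of _ z]) simp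
  have none: "emb TwoP2 H" if "\<not> adjacent H w y" "\<not> adjacent H w z" "\<not> adjacent H x y" "\<not> adjacent H x z"
    unfolding emb_TwoP2[OF H] using * that
    by (intro exI[of _ w] exI[of _ x] exI[of _ y] exI[of _ z]) simp
  show ?thesis
    using none one[of w x y z] two[of w x y z] one[of w x z y] two[of w x z y]
      one[of x w y z] two[of x w y z] one[of x w z y] two[of x w z y] * comm[of x w] comm[of z y]
      tri[of w y z] tri[of x y z] by simp blast
qed

text \<open>
  The cases are arranged by whether the graph contains a triangle or three independent vertices,
  since this decides in which of the constructions below it can occur.  For C4, 4P1, the claw, the
  diamond and K4 full isomorphism is recorded: it shows that they embed wherever \<open>H\<close> does, and it is
  what membership in an excluded family means.
\<close>

lemma classification:
  assumes H: "simple_graph H" and "card (verts H) \<le> 4"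
  shows "emb H P4 \<or> emb H TwoP2 \<or> graph_iso H C4 \<or>
    has_cotriangle H \<and> (graph_iso H FourP1 \<or> emb H P2_2P1 \<or> emb H P3_P1 \<or> graph_iso H claw) \<or>
    has_triangle H \<and> (emb H K3_P1 \<or> emb H paw \<or> graph_iso H diamond \<or> graph_iso H K4)"
proof (cases "card (verts H) = 4")
  case True
  have "graph_iso H X" if "emb X H" "card (verts X) = 4" for X :: "nat graph"
    using emb_imp_graph_iso[OF that(1)] H True that(2) by (simp add: simple_graph_def)
  then show ?thesis
    using emb_if_cotriangle[OF H True] emb_if_triangle[OF H True] emb_if_Ramsey[OF H True]
      graph_iso_imp_emb[of H] card_small_graphs by metis
next
  case False
  then show ?thesis using emb_at_most_three[OF H] assms(2) by linarith
qed

section \<open>Full components and short descriptions of minimal separators\<close>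

text \<open>
  Connectedness is stated as the absence of a proper nonempty subset closed under adjacency.  This
  is the form in which it is applied throughout: a property that spreads along edges holds
  everywhere.
\<close>

definition connected_in :: "'v graph \<Rightarrow> 'v set \<Rightarrow> bool" where
  "connected_in G A \<longleftrightarrow> A \<subseteq> verts G \<and> A \<noteq> {} \<and>
     (\<forall>X\<subseteq>A. X \<noteq> {} \<and> (\<forall>x\<in>X. \<forall>y\<in>A. adjacent G x y \<longrightarrow> y \<in> X) \<longrightarrow> X = A)"

text \<open>
  \<open>A\<close> and \<open>B\<close> are two full components of \<open>G - S\<close>: connected, with all
  their edges ending inside \<open>A \<union> S\<close> and \<open>B \<union> S\<close> respectively, and every vertex of \<open>S\<close> has a
  neighbour in both.
\<close>

definition full_pair :: "'v graph \<Rightarrow> 'v set \<Rightarrow> 'v set \<Rightarrow> 'v set \<Rightarrow> bool" where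
  "full_pair G S A B \<longleftrightarrow> connected_in G A \<and> connected_in G B \<and>
     A \<inter> B = {} \<and> A \<inter> S = {} \<and> B \<inter> S = {} \<and> S \<subseteq> verts G \<and>
     (\<forall>a\<in>A. \<forall>v. adjacent G a v \<longrightarrow> v \<in> A \<union> S) \<and> (\<forall>b\<in>B. \<forall>v. adjacent G b v \<longrightarrow> v \<in> B \<union> S) \<and>
     (\<forall>s\<in>S. (\<exists>a\<in>A. adjacent G s a) \<and> (\<exists>b\<in>B. adjacent G s b))"

lemma full_pair_sym: "full_pair G S A B \<Longrightarrow> full_pair G S B A"
  unfolding full_pair_def by blast

lemma full_pairD:
  assumes "full_pair G S A B"
  shows "connected_in G A" "connected_in G B" "A \<inter> B = {}" "A \<inter> S = {}" "B \<inter> S = {}"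
    "S \<subseteq> verts G" "A \<subseteq> verts G" "B \<subseteq> verts G" "A \<noteq> {}" "B \<noteq> {}"
    "\<And>a v. a \<in> A \<Longrightarrow> adjacent G a v \<Longrightarrow> v \<in> A \<union> S"
    "\<And>b v. b \<in> B \<Longrightarrow> adjacent G b v \<Longrightarrow> v \<in> B \<union> S"
    "\<And>s. s \<in> S \<Longrightarrow> \<exists>a\<in>A. adjacent G s a" "\<And>s. s \<in> S \<Longrightarrow> \<exists>b\<in>B. adjacent G s b"
    "\<And>a b. a \<in> A \<Longrightarrow> b \<in> B \<Longrightarrow> \<not> adjacent G a b" "\<And>a b. a \<in> A \<Longrightarrow> b \<in> B \<Longrightarrow> \<not> adjacent G b a"
    "\<And>a s. a \<in> A \<Longrightarrow> s \<in> S \<Longrightarrow> a \<noteq> s" "\<And>b s. b \<in> B \<Longrightarrow> s \<in> S \<Longrightarrow> b \<noteq> s"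
    "\<And>a b. a \<in> A \<Longrightarrow> b \<in> B \<Longrightarrow> a \<noteq> b"
proof -
  note d = assms[unfolded full_pair_def]
  show A: "connected_in G A" and B: "connected_in G B"
    and AB: "A \<inter> B = {}" and AS: "A \<inter> S = {}" and BS: "B \<inter> S = {}" and S: "S \<subseteq> verts G"
    using d by simp_all
  show "A \<subseteq> verts G" "A \<noteq> {}" using A by (simp_all add: connected_in_def)
  show "B \<subseteq> verts G" "B \<noteq> {}" using B by (simp_all add: connected_in_def)
  show out: "v \<in> A \<union> S" if "a \<in> A" "adjacent G a v" for a v using d that by simp
  show "v \<in> B \<union> S" if "b \<in> B" "adjacent G b v" for b v using d that by simp
  show "\<exists>a\<in>A. adjacent G s a" "\<exists>b\<in>B. adjacent G s b" if "s \<in> S" for s using d that by simp_all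
  show "\<not> adjacent G a b" if "a \<in> A" "b \<in> B" for a b
    using out[OF that(1), of b] that(2) AB BS by blast
  then show "\<not> adjacent G b a" if "a \<in> A" "b \<in> B" for a b
    using that by (metis adjacent_sym)
  show "a \<noteq> s" if "a \<in> A" "s \<in> S" for a s using that AS by blast
  show "b \<noteq> s" if "b \<in> B" "s \<in> S" for b s using that BS by blast
  show "a \<noteq> b" if "a \<in> A" "b \<in> B" for a b using that AB by blast
qed

lemma connected_inD:
  assumes "connected_in G A" "X \<subseteq> A" "x \<in> X"
    and "\<And>x y. x \<in> X \<Longrightarrow> y \<in> A \<Longrightarrow> adjacent G x y \<Longrightarrow> y \<in> X"
  shows "X = A"
proof -
  have "X \<noteq> {} \<and> (\<forall>x\<in>X. \<forall>y\<in>A. adjacent G x y \<longrightarrow> y \<in> X)" using assms(3,4) by auto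
  with assms(1,2) show ?thesis unfolding connected_in_def by simp
qed

lemma component_delete:
  "component (delete_verts G S) v = {w \<in> verts G - S.
     (\<lambda>x y. adjacent G x y \<and> x \<notin> S \<and> y \<notin> S)\<^sup>*\<^sup>* v w}" if "simple_graph G"
proof -
  have "adjacent (delete_verts G S) = (\<lambda>x y. adjacent G x y \<and> x \<notin> S \<and> y \<notin> S)"
    using adjacent_verts[OF that] by (fastforce simp: fun_eq_iff adjacent_def delete_verts_def induced_def)
  then show ?thesis by (simp add: component_def delete_verts_def induced_def)
qed

lemma component_eq_iff:
  assumes "simple_graph G" "a \<in> verts G - S" "b \<in> verts G - S"
  shows "component (delete_verts G S) a = component (delete_verts G S) b \<longleftrightarrow>
    (\<lambda>x y. adjacent G x y \<and> x \<notin> S \<and> y \<notin> S)\<^sup>*\<^sup>* a b" (is "_ \<longleftrightarrow> ?R\<^sup>*\<^sup>* a b")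
proof -
  have "symp ?R\<^sup>*\<^sup>*"
    by (intro symp_rtranclp sympI) (simp add: adjacent_commute)
  then show ?thesis
    unfolding component_delete[OF assms(1)] using assms(2,3)
    by (auto dest: sympD intro: rtranclp_trans)
qed

lemma connected_in_component:
  assumes G: "simple_graph G" and a: "a \<in> verts G - S"
  shows "connected_in G (component (delete_verts G S) a)"
proof -
  let ?R = "\<lambda>x y. adjacent G x y \<and> x \<notin> S \<and> y \<notin> S"
  let ?A = "component (delete_verts G S) a"
  note A = component_delete[OF G, of S a]
  have "X = ?A" if X: "X \<subseteq> ?A" "X \<noteq> {}" "\<forall>x\<in>X. \<forall>y\<in>?A. adjacent G x y \<longrightarrow> y \<in> X" for X
  proof -
    obtain x where x: "x \<in> X" using X(2) by blast
    have "y \<in> X" if "?R\<^sup>*\<^sup>* x y" for y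
      using that
    proof (induction rule: rtranclp_induct)
      case base
      show ?case by (fact x)
    next
      case (step y z)
      then have "?R\<^sup>*\<^sup>* a y" using X(1) A by blast
      then have "?R\<^sup>*\<^sup>* a z" using step.hyps(2) by (rule rtranclp.rtrancl_into_rtrancl)
      moreover have "z \<in> verts G - S" using step.hyps(2) adjacent_verts[OF G] by blast
      ultimately have "z \<in> ?A" unfolding A by blast
      with step X(3) show ?case by blast
    qed
    moreover have "?R\<^sup>*\<^sup>* x y" if "y \<in> ?A" for y
    proof -
      have "?R\<^sup>*\<^sup>* a x" using x X(1) A by blast
      moreover have "symp ?R\<^sup>*\<^sup>*"
        by (intro symp_rtranclp sympI) (simp add: adjacent_commute)
      ultimately have "?R\<^sup>*\<^sup>* x a" by (auto dest: sympD)
      with that show ?thesis unfolding A by (auto intro: rtranclp_trans)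
    qed
    ultimately show ?thesis using X(1) by blast
  qed
  moreover have "?A \<subseteq> verts G" "a \<in> ?A" unfolding A using a by auto
  ultimately show ?thesis unfolding connected_in_def by blast
qed

text \<open>
  The components of the two separated vertices are full.  If \<open>s\<close> had no neighbour in one of them,
  putting \<open>s\<close> back would leave that component unchanged, so \<open>S - {s}\<close> would still separate.
\<close>

lemma minimal_separator_full_pair:
  assumes G: "simple_graph G" and "minimal_separator G S"
  shows "\<exists>A B. full_pair G S A B"
proof -
  obtain a b where "separator G a b S" and min: "\<And>T. T \<subset> S \<Longrightarrow> \<not> separator G a b T"
    and ab: "a \<in> verts G" "b \<in> verts G"
    using assms(2) unfolding minimal_separator_def minimal_ab_separator_def by blast
  then have S: "S \<subseteq> verts G - {a, b}"
    and ne: "component (delete_verts G S) a \<noteq> component (delete_verts G S) b"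
    unfolding separator_def by auto
  define R where "R T x y \<longleftrightarrow> adjacent G x y \<and> x \<notin> T \<and> y \<notin> T" for T x y
  let ?C = "component (delete_verts G S)"
  have C: "?C v = {w \<in> verts G - S. (R S)\<^sup>*\<^sup>* v w}" for v
    unfolding component_delete[OF G] R_def ..
  have sym: "(R T)\<^sup>*\<^sup>* x y \<Longrightarrow> (R T)\<^sup>*\<^sup>* y x" for T x y
    using symp_rtranclp[of "R T"] by (auto simp: R_def adjacent_commute symp_def)
  have a: "a \<in> verts G - S" and b: "b \<in> verts G - S" using S ab by auto
  have nab: "\<not> (R S)\<^sup>*\<^sup>* a b"
    using ne component_eq_iff[OF G a b] unfolding R_def by simp
  have reach: "(R (S - {s}))\<^sup>*\<^sup>* a b" if "s \<in> S" for s
  proof -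
    have "S - {s} \<subset> S" using that by blast
    then have "\<not> separator G a b (S - {s})" by (rule min)
    then show ?thesis
      using component_eq_iff[OF G, of a "S - {s}" b] S a b unfolding separator_def R_def by auto
  qed
  have nbr: "\<exists>x\<in>?C u. adjacent G s x"
    if "s \<in> S" "u \<in> verts G - S" "(R (S - {s}))\<^sup>*\<^sup>* u w" "w \<in> verts G - S" "\<not> (R S)\<^sup>*\<^sup>* u w" for s u w
  proof (rule ccontr)
    assume no: "\<not> ?thesis"
    \<comment> \<open>a component without a neighbour of \<open>s\<close> is still closed once \<open>s\<close> is put back\<close>
    have "y \<in> ?C u" if "(R (S - {s}))\<^sup>*\<^sup>* u y" for y
      using that
    proof (induction rule: rtranclp_induct)
      case base
      show ?case using \<open>u \<in> _\<close> by (simp add: C)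
    next
      case (step y z)
      then have "z \<noteq> s" using no by (auto simp: R_def adjacent_commute)
      with step have yz: "R S y z" by (auto simp: R_def C)
      have "(R S)\<^sup>*\<^sup>* u y" using step.IH by (simp add: C)
      then have "(R S)\<^sup>*\<^sup>* u z" using yz by (rule rtranclp.rtrancl_into_rtrancl)
      then show ?case using yz adjacent_verts[OF G] by (auto simp: C R_def)
    qed
    then show False using that by (auto simp: C)
  qed
  have out: "v \<in> ?C u \<union> S" if "x \<in> ?C u" "adjacent G x v" for u x v
  proof (cases "v \<in> S")
    case False
    then have "R S x v" using that by (auto simp: R_def C)
    moreover have "(R S)\<^sup>*\<^sup>* u x" using that by (simp add: C)
    ultimately have "(R S)\<^sup>*\<^sup>* u v" by (rule rtranclp.rtrancl_into_rtrancl[rotated])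
    then show ?thesis using False adjacent_verts[OF G that(2)] by (simp add: C)
  qed simp
  have "full_pair G S (?C a) (?C b)"
    unfolding full_pair_def
  proof (intro conjI ballI allI impI)
    show "?C a \<inter> ?C b = {}" using nab sym by (auto simp: C intro: rtranclp_trans)
    show "\<exists>x\<in>?C a. adjacent G s x" if "s \<in> S" for s
      using nbr[OF that a reach[OF that] b nab] .
    show "\<exists>x\<in>?C b. adjacent G s x" if "s \<in> S" for s
      using nbr[OF that b sym[OF reach[OF that]] a] nab sym by blast
    show "connected_in G (?C a)" "connected_in G (?C b)"
      using connected_in_component[OF G] a b by blast+
    show "?C a \<inter> S = {}" "?C b \<inter> S = {}" by (auto simp: C)
    show "v \<in> ?C a \<union> S" if "x \<in> ?C a" "adjacent G x v" for x v using out that by blast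
    show "v \<in> ?C b \<union> S" if "x \<in> ?C b" "adjacent G x v" for x v using out that by blast
    show "S \<subseteq> verts G" using S by blast
  qed
  then show ?thesis by blast
qed

definition nbhd :: "'v graph \<Rightarrow> 'v set \<Rightarrow> 'v set" where
  "nbhd G T = {v \<in> verts G - T. \<exists>t\<in>T. adjacent G t v}"

text \<open>
  A separator is described by at most \<open>2 * k\<close> vertices: either it has at most \<open>k\<close> elements, or
  it is the common neighbourhood of two sets of at most \<open>k\<close> vertices.  For fixed \<open>k\<close> a graph has
  only polynomially many such sets, which is how every positive result below is obtained.
\<close>

definition described :: "nat \<Rightarrow> 'v graph \<Rightarrow> 'v set \<Rightarrow> bool" where
  "described k G S \<longleftrightarrow> S \<subseteq> verts G \<and> card S \<le> k \<or>
     (\<exists>T U. T \<subseteq> verts G \<and> card T \<le> k \<and> U \<subseteq> verts G \<and> card U \<le> k \<and> S = nbhd G T \<inter> nbhd G U)"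

text \<open>
  A vertex adjacent to both \<open>A\<close> and \<open>B\<close> must lie in \<open>S\<close>.  Hence it suffices that a few
  vertices on each side reach all of \<open>S\<close>.
\<close>

lemma described_if_dominated:
  assumes G: "simple_graph G" and pair: "full_pair G S A B" 
    and T: "T \<subseteq> A" "card T \<le> k" "\<And>s. s \<in> S \<Longrightarrow> \<exists>t\<in>T. adjacent G s t"
    and U: "U \<subseteq> B" "card U \<le> k" "\<And>s. s \<in> S \<Longrightarrow> \<exists>u\<in>U. adjacent G s u"
  shows "described k G S"
proof -
  note p = full_pairD[OF pair]
  have "nbhd G T \<inter> nbhd G U \<subseteq> S"
  proof
    fix v assume v: "v \<in> nbhd G T \<inter> nbhd G U"
    then obtain t u where "t \<in> A" "u \<in> B" "adjacent G t v" "adjacent G u v"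
      using T(1) U(1) unfolding nbhd_def by blast
    then show "v \<in> S" using p(3) p(11)[of t v] p(12)[of u v] by blast
  qed
  moreover have "S \<subseteq> nbhd G T \<inter> nbhd G U"
  proof
    fix s assume s: "s \<in> S"
    obtain t u where "t \<in> T" "adjacent G s t" "u \<in> U" "adjacent G s u" using T(3) U(3) s by blast
    then show "s \<in> nbhd G T \<inter> nbhd G U"
      using s p(4-6) T(1) U(1) by (auto simp: nbhd_def adjacent_commute)
  qed
  ultimately have "S = nbhd G T \<inter> nbhd G U" by blast
  moreover have "T \<subseteq> verts G" "U \<subseteq> verts G" using T(1) U(1) p(7,8) by auto
  ultimately show ?thesis
    unfolding described_def using T(2) U(2) by (intro disjI2 exI[of _ T] exI[of _ U]) simp
qed

lemma described_if_small_side: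
  assumes "simple_graph G" "full_pair G S A B" "card A \<le> k"
  shows "described k G S"
proof -
  note p = full_pairD[OF assms(2)]
  have "S = nbhd G A"
  proof (intro equalityI subsetI)
    fix s assume "s \<in> S"
    then obtain a where "a \<in> A" "adjacent G s a" using p(13) by blast
    with \<open>s \<in> S\<close> p(4,6) show "s \<in> nbhd G A"
      unfolding nbhd_def by (auto dest: adjacent_sym)
  next
    fix v assume "v \<in> nbhd G A"
    then obtain a where "a \<in> A" "adjacent G a v" "v \<notin> A" unfolding nbhd_def by blast
    then show "v \<in> S" using p(11) by blast
  qed
  then have "S = nbhd G A \<inter> nbhd G A" by simp
  then show ?thesis unfolding described_def using p(7) assms(3)
    by (intro disjI2 exI[of _ A]) simp
qed

lemma described_mono: "described k G S \<Longrightarrow> k \<le> l \<Longrightarrow> described l G S"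
  unfolding described_def by (elim disjE exE conjE) (blast intro: le_trans)+

text \<open>
  Small subsets are counted as the ranges of short lists, which gives a polynomial bound without
  binomial coefficients.
\<close>

lemma card_small_subsets:
  assumes "finite V"
  shows "finite {T. T \<subseteq> V \<and> card T \<le> k}" "card {T. T \<subseteq> V \<and> card T \<le> k} \<le> (\<Sum>i\<le>k. card V ^ i)"
proof -
  let ?L = "{xs. set xs \<subseteq> V \<and> length xs \<le> k}"
  have fin: "finite ?L" using assms by (rule finite_lists_length_le)
  have "{T. T \<subseteq> V \<and> card T \<le> k} \<subseteq> set ` ?L"
  proof
    fix T assume T: "T \<in> {T. T \<subseteq> V \<and> card T \<le> k}"
    then obtain xs where "set xs = T" "distinct xs"
      using assms finite_distinct_list finite_subset by (metis mem_Collect_eq)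
    with T show "T \<in> set ` ?L" by (auto simp: distinct_card)
  qed
  then have "card {T. T \<subseteq> V \<and> card T \<le> k} \<le> card ?L"
    by (rule surj_card_le[OF fin])
  then show "card {T. T \<subseteq> V \<and> card T \<le> k} \<le> (\<Sum>i\<le>k. card V ^ i)"
    by (simp add: card_lists_length_le[OF assms])
  show "finite {T. T \<subseteq> V \<and> card T \<le> k}" using assms by simp
qed

lemma tame_if_described:
  assumes "\<And>G S. G \<in> \<G> \<Longrightarrow> minimal_separator G S \<Longrightarrow> described k G S"
    and "\<And>G. G \<in> \<G> \<Longrightarrow> simple_graph G"
  shows "tame \<G>"
proof -
  define q :: "real poly" where "q = (\<Sum>i\<le>k. monom 1 i)"
  have "real (num_min_seps G) \<le> poly (q + q * q) (real (card (verts G)))" if "G \<in> \<G>" for G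
  proof -
    let ?V = "verts G"
    let ?N = "\<Sum>i\<le>k. card ?V ^ i"
    let ?P = "{T. T \<subseteq> ?V \<and> card T \<le> k}"
    have "finite ?V" using assms(2)[OF that] by (simp add: simple_graph_def)
    note P = card_small_subsets[OF this, of k]
    let ?D = "?P \<union> (\<lambda>(T, U). nbhd G T \<inter> nbhd G U) ` (?P \<times> ?P)"
    have "{S. minimal_separator G S} \<subseteq> ?D"
      using assms(1)[OF that] by (fastforce simp: described_def)
    then have "num_min_seps G \<le> card ?D"
      unfolding num_min_seps_def using P(1) by (intro card_mono) auto
    also have "\<dots> \<le> card ?P + card (?P \<times> ?P)"
      using P(1) by (intro order.trans[OF card_Un_le] add_mono card_image_le) auto
    also have "\<dots> \<le> ?N + ?N * ?N"
      using P(2) by (simp add: card_cartesian_product add_mono mult_le_mono)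
    finally have "real (num_min_seps G) \<le> real (?N + ?N * ?N)" by linarith
    also have "\<dots> = poly (q + q * q) (real (card ?V))"
      by (simp add: q_def poly_sum poly_monom)
    finally show ?thesis .
  qed
  then show ?thesis unfolding tame_def by blast
qed

definition clique :: "'v graph \<Rightarrow> 'v set \<Rightarrow> bool" where
  "clique G Q \<longleftrightarrow> (\<forall>x\<in>Q. \<forall>y\<in>Q. x \<noteq> y \<longrightarrow> adjacent G x y)"

lemma connected_in_neighbour:
  assumes "connected_in G A" "x \<in> A" "A \<noteq> {x}"
  shows "\<exists>y\<in>A. adjacent G x y"
  using connected_inD[OF assms(1), of "{x}" x] assms(2,3) by blast

lemma connected_in_path3:
  assumes A: "connected_in G A" and "\<not> clique G A"
  obtains x y z where "{x, y, z} \<subseteq> A" "x \<noteq> z" "adjacent G x y" "adjacent G y z" "\<not> adjacent G x z"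
proof -
  obtain x z where xz: "x \<in> A" "z \<in> A" "x \<noteq> z" "\<not> adjacent G x z"
    using assms(2) unfolding clique_def by blast
  let ?X = "{y \<in> A. y = x \<or> adjacent G x y}"
  have "\<exists>y\<in>?X. \<exists>w\<in>A. adjacent G y w \<and> w \<notin> ?X"
  proof (rule ccontr)
    assume no: "\<not> ?thesis"
    have "?X = A"
    proof (rule connected_inD[OF A])
      show "x \<in> ?X" using xz by simp
      show "w \<in> ?X" if "y \<in> ?X" "w \<in> A" "adjacent G y w" for y w using no that by blast
    qed simp
    then have "z \<in> ?X" using xz(2) by simp
    with xz show False by simp
  qed
  then obtain y w where "y \<in> ?X" "w \<in> A" "adjacent G y w" "w \<notin> ?X" by blast
  then show thesis using that[of x y w] xz by auto
qed

lemma finite_connected_in: "simple_graph G \<Longrightarrow> connected_in G A \<Longrightarrow> finite A"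
  unfolding simple_graph_def connected_in_def by (metis finite_subset)

section \<open>Forbidding P4, forbidding 2P2\<close>

text \<open>
  Every vertex \<open>s\<close> of the separator is adjacent to all of \<open>A\<close>: along an edge of \<open>A\<close> leaving
  the neighbourhood of \<open>s\<close>, the two ends, \<open>s\<close> and a neighbour of \<open>s\<close> in \<open>B\<close> would induce a P4.
  So one vertex on each side reaches all of \<open>S\<close>.
\<close>

lemma described_if_no_P4:
  assumes G: "simple_graph G" and pair: "full_pair G S A B" and free: "\<not> emb P4 G"
  shows "described 1 G S"
proof -
  have complete: "adjacent G s a"
    if pair: "full_pair G S A B" and s: "s \<in> S" and a: "a \<in> A" for s a A B
  proof -
    note p = full_pairD[OF pair]
    obtain x b where xb: "x \<in> A" "adjacent G s x" "b \<in> B" "adjacent G s b"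
      using p(13,14) s by blast
    let ?X = "{y \<in> A. adjacent G s y}"
    have "?X = A"
    proof (rule connected_inD[OF p(1)])
      show "x \<in> ?X" using xb by simp
      show "y \<in> ?X" if y: "x \<in> ?X" "y \<in> A" "adjacent G x y" for x y
      proof (rule ccontr)
        assume "y \<notin> ?X"
        then have n: "\<not> adjacent G y s" using y(2) adjacent_sym by fastforce
        have "emb P4 G"
        proof (rule emb_P4I[OF G])
          show "{y, x, s, b} \<subseteq> verts G" using y s xb p(6,7,8) by blast
          show "distinct [y, x, s, b]"
            using y s xb(3) p(17)[of x s] p(17)[of y s] p(18)[of b s] p(19)[of x b] p(19)[of y b]
              adjacent_verts(3)[OF G y(3)] by auto
          show "adjacent G y x" "adjacent G x s" "adjacent G s b"
            using y xb adjacent_sym by fast+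
          show "\<not> adjacent G y s" by (fact n)
          show "\<not> adjacent G y b" "\<not> adjacent G x b" using p(15) y xb(3) by blast+
        qed
        with free show False ..
      qed
    qed simp
    with a show ?thesis by blast
  qed
  note p = full_pairD[OF pair]
  obtain a b where ab: "a \<in> A" "b \<in> B" using p(9,10) by blast
  show ?thesis
  proof (rule described_if_dominated[OF G pair])
    show "{a} \<subseteq> A" "{b} \<subseteq> B" using ab by auto
    show "\<exists>t\<in>{a}. adjacent G s t" if "s \<in> S" for s using complete[OF pair that] ab by blast
    show "\<exists>t\<in>{b}. adjacent G s t" if "s \<in> S" for s
      using complete[OF full_pair_sym[OF pair] that] ab by blast
  qed simp_all
qed

text \<open>
  An edge in each of the two components would form 2P2, so one of them is a single vertex.
\<close>

lemma described_if_no_TwoP2: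
  assumes G: "simple_graph G" and pair: "full_pair G S A B" and free: "\<not> emb TwoP2 G"
  shows "described 1 G S"
proof -
  note p = full_pairD[OF pair]
  obtain a b where ab: "a \<in> A" "b \<in> B" using p(9,10) by blast
  have "A = {a} \<or> B = {b}"
  proof (rule ccontr)
    assume no: "\<not> ?thesis"
    obtain x y where xy: "x \<in> A" "adjacent G a x" "y \<in> B" "adjacent G b y"
      using no connected_in_neighbour[OF p(1) ab(1)] connected_in_neighbour[OF p(2) ab(2)] by blast
    have "emb TwoP2 G"
    proof (rule emb_TwoP2I[OF G])
      show "{a, x, b, y} \<subseteq> verts G" using xy ab p(7,8) by blast
      show "distinct [a, x, b, y]"
        using xy ab p(19) adjacent_verts(3)[OF G] by auto
    qed (use xy ab p(15) in blast)+
    with free show False ..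
  qed
  then show ?thesis
    using described_if_small_side[OF G pair, of 1]
      described_if_small_side[OF G full_pair_sym[OF pair], of 1] by auto
qed

section \<open>Full components that are cliques\<close>

lemma four_distinct:
  assumes "\<not> card A \<le> 3"
  obtains x y z w where "{x, y, z, w} \<subseteq> A" "distinct [x, y, z, w]"
proof -
  obtain T where T: "T \<subseteq> A" "card T = Suc 3"
    using assms obtain_subset_with_card_n[of "Suc 3" A] by auto
  then obtain x U where "T = insert x U" "x \<notin> U" "card U = 3" using card_eq_SucD by blast
  moreover obtain y z w where "U = {y, z, w}" "y \<noteq> z" "z \<noteq> w" "y \<noteq> w"
    using \<open>card U = 3\<close> by (auto simp: card_3_iff)
  ultimately show thesis using T(1) that[of x y z w] by simp
qed

text \<open>
  A connected set that is not a clique contains an induced path on three vertices.  If both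
  components did, the graph would contain 2P3, and with it each of the three forbidden graphs.
\<close>

lemma clique_side:
  assumes G: "simple_graph G" and pair: "full_pair G S A B"
    and free: "\<not> emb FourP1 G \<or> \<not> emb P2_2P1 G \<or> \<not> emb P3_P1 G"
  shows "clique G A \<or> clique G B"
proof (rule ccontr)
  assume no: "\<not> ?thesis"
  note p = full_pairD[OF pair]
  have not_clique: "\<not> clique G A" "\<not> clique G B" using no by blast+
  obtain x y z where A: "{x, y, z} \<subseteq> A" "x \<noteq> z" "adjacent G x y" "adjacent G y z" "\<not> adjacent G x z"
    by (rule connected_in_path3[OF p(1) not_clique(1)])
  obtain x' y' z' where B: "{x', y', z'} \<subseteq> B" "x' \<noteq> z'" "adjacent G x' y'" "adjacent G y' z'"
      "\<not> adjacent G x' z'"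
    by (rule connected_in_path3[OF p(2) not_clique(2)])
  have inA: "x \<in> A" "y \<in> A" "z \<in> A" and inB: "x' \<in> B" "y' \<in> B" "z' \<in> B"
    using A(1) B(1) by simp_all
  have V: "x \<in> verts G" "y \<in> verts G" "z \<in> verts G" "x' \<in> verts G" "y' \<in> verts G" "z' \<in> verts G"
    using inA inB p(7,8) by blast+
  have ne: "x \<noteq> y" "y \<noteq> z" "x' \<noteq> y'" "y' \<noteq> z'"
    using A(3,4) B(3,4) by (auto dest: adjacent_verts(3)[OF G])
  note nadj = inA[THEN p(15), OF inB(1)] inA[THEN p(15), OF inB(3)]
  note ne = ne A(2) B(2) inA[THEN p(19), OF inB(1)] inA[THEN p(19), OF inB(3)]
  have "emb FourP1 G"
    by (rule emb_FourP1I[OF G, of x z x' z']) (use V ne A B nadj in simp_all)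
  moreover have "emb P2_2P1 G"
    by (rule emb_P2_2P1I[OF G, of x y x' z']) (use V ne A B nadj in simp_all)
  moreover have "emb P3_P1 G"
    by (rule emb_P3_P1I[OF G, of x y z x']) (use V ne A B nadj in simp_all)
  ultimately show False using free by blast
qed

text \<open>
  Four vertices of the clique \<open>A\<close> form K4, three of them together with a vertex of \<open>B\<close> form
  K3 + P1, and a vertex of a nonempty \<open>S\<close> creates a paw: if it sees two vertices of \<open>A\<close>, the
  pendant vertex is its neighbour in \<open>B\<close>; if it sees only one, it is the pendant vertex itself.
\<close>

lemma clique_side_small:
  assumes G: "simple_graph G" and pair: "full_pair G S A B" and cl: "clique G A"
    and free: "\<not> emb paw G \<or> \<not> emb K3_P1 G \<or> \<not> emb K4 G"
  shows "card A \<le> 3 \<or> S = {}"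
proof (rule ccontr)
  assume no: "\<not> ?thesis"
  note p = full_pairD[OF pair]
  obtain s where s: "s \<in> S" using no by blast
  obtain a b where ab: "a \<in> A" "adjacent G s a" "b \<in> B" "adjacent G s b" using p(13,14) s by blast
  have "\<not> card (A - {a}) \<le> 2" using no ab(1) finite_connected_in[OF G p(1)] by auto
  then obtain T where T: "T \<subseteq> A - {a}" "card T = 3"
    using obtain_subset_with_card_n[of 3 "A - {a}"] by auto
  then obtain x y z where xyz: "{x, y, z} \<subseteq> A - {a}" "x \<noteq> y" "x \<noteq> z" "y \<noteq> z"
    by (auto simp: card_3_iff)
  have inA: "a \<in> A" "x \<in> A" "y \<in> A" "z \<in> A" using ab(1) xyz(1) by simp_all
  have ne: "a \<noteq> x" "a \<noteq> y" "a \<noteq> z" "x \<noteq> y" "x \<noteq> z" "y \<noteq> z" using xyz by auto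
  have adj: "adjacent G a x" "adjacent G a y" "adjacent G a z" "adjacent G x y" "adjacent G x z" "adjacent G y z"
    using cl inA ne unfolding clique_def by simp_all
  have V: "a \<in> verts G" "x \<in> verts G" "y \<in> verts G" "z \<in> verts G" "s \<in> verts G" "b \<in> verts G"
    using inA ab(3) s p(6-8) by blast+
  note nb = inA[THEN p(15), OF ab(3)]
  note ne = ne inA[THEN p(17), OF s] inA[THEN p(19), OF ab(3)] p(18)[OF ab(3) s]
  have K4: "emb K4 G"
    by (rule emb_K4I[OF G, of a x y z]) (use V ne adj in simp_all)
  have K3_P1: "emb K3_P1 G"
    by (rule emb_K3_P1I[OF G, of a x y b]) (use V ne adj nb in simp_all)
  have paw: "emb paw G"
  proof (cases "adjacent G s x \<or> adjacent G s y")
    case True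
    then obtain u where u: "u \<in> {x, y}" "adjacent G s u" by blast
    have "{s, a, u, b} \<subseteq> verts G" "distinct [s, a, u, b]" "adjacent G a u"
      "\<not> adjacent G a b" "\<not> adjacent G u b"
      using V ne u adj nb by auto
    then show ?thesis
      by (rule emb_pawI[OF G _ _ ab(2) u(2) ab(4)])
  next
    case False
    have "{a, x, y, s} \<subseteq> verts G" "distinct [a, x, y, s]" "adjacent G a x" "adjacent G a y"
      "adjacent G x y" using V ne adj by auto
    moreover have "adjacent G a s" "\<not> adjacent G x s" "\<not> adjacent G y s"
      using False ab(2) by (auto dest: adjacent_sym)
    ultimately show ?thesis by (intro emb_pawI[OF G])
  qed
  show False using K4 K3_P1 paw free by blast
qed

lemma described_if_clique_side:
  assumes G: "simple_graph G" and pair: "full_pair G S A B"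
    and F: "\<not> emb FourP1 G \<or> \<not> emb P2_2P1 G \<or> \<not> emb P3_P1 G"
    and F': "\<not> emb paw G \<or> \<not> emb K3_P1 G \<or> \<not> emb K4 G"
  shows "described 3 G S"
proof -
  have *: "described 3 G S" if pair: "full_pair G S A B" and "clique G A" for A B
  proof (cases "S = {}")
    case True
    then show ?thesis unfolding described_def by simp
  next
    case False
    with clique_side_small[OF G that F'] have "card A \<le> 3" by blast
    then show ?thesis by (rule described_if_small_side[OF G pair])
  qed
  show ?thesis
    using clique_side[OF G pair F] *[OF pair] *[OF full_pair_sym[OF pair]] by blast
qed

section \<open>Forbidding the claw together with the paw or K3 + P1\<close>

definition nbrs :: "'v graph \<Rightarrow> 'v set \<Rightarrow> 'v \<Rightarrow> 'v set" where
  "nbrs G A x = {y \<in> A. adjacent G x y}"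

text \<open>
  A connected graph of maximum degree two is a path or a cycle, so it has at most two vertices of
  degree at most one.  The induction removes an end \<open>x\<close>, whose neighbour becomes an end in its place.
\<close>

lemma card_ends_le_2:
  assumes G: "simple_graph G"
  shows "connected_in G A \<Longrightarrow> \<forall>x\<in>A. card (nbrs G A x) \<le> 2 \<Longrightarrow>
    card {x \<in> A. card (nbrs G A x) \<le> 1} \<le> 2"
proof (induction "card A" arbitrary: A)
  case 0
  then show ?case using finite_connected_in[OF G] by (auto simp: connected_in_def)
next
  case (Suc n)
  define ends where "ends X = {x \<in> X. card (nbrs G X x) \<le> 1}" for X
  have finA: "finite A" using finite_connected_in[OF G Suc.prems(1)] .
  have fin: "finite (nbrs G A v)" for v using finA by (simp add: nbrs_def)
  have "card (ends A) \<le> 2"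
  proof (cases "\<exists>x\<in>A. card (nbrs G A x) \<le> 1 \<and> A \<noteq> {x}")
    case False
    show ?thesis
    proof (cases "\<exists>x. A = {x}")
      case True
      then show ?thesis using card_mono[of A "ends A"] finA by (auto simp: ends_def)
    next
      case no: False
      then have "ends A = {}" using False unfolding ends_def by blast
      then show ?thesis by simp
    qed
  next
    case True
    then obtain x where x: "x \<in> A" "card (nbrs G A x) \<le> 1" "A \<noteq> {x}" by blast
    obtain y where y: "y \<in> A" "adjacent G x y" using connected_in_neighbour[OF Suc.prems(1) x(1,3)] by blast
    have xy: "x \<noteq> y" using adjacent_verts(3)[OF G y(2)] .
    have "y \<in> nbrs G A x" using y by (simp add: nbrs_def)
    then have "nbrs G A x = {y}"
      using x(2) fin[of x] by (metis card_0_eq card_1_singletonE empty_iff le_antisym less_one not_le singletonD)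
    then have only: "v = y" if "v \<in> A" "adjacent G x v" for v using that unfolding nbrs_def by blast
    let ?A = "A - {x}"
    have nbrs: "nbrs G ?A v = nbrs G A v - {x}" for v by (auto simp: nbrs_def)
    have "connected_in G ?A"
      unfolding connected_in_def
    proof (intro conjI allI impI)
      show "?A \<subseteq> verts G" using Suc.prems(1) by (auto simp: connected_in_def)
      show "?A \<noteq> {}" using x y xy by blast
      show "X = ?A" if "X \<subseteq> ?A" and X: "X \<noteq> {} \<and> (\<forall>v\<in>X. \<forall>w\<in>?A. adjacent G v w \<longrightarrow> w \<in> X)" for X
      proof (cases "y \<in> X")
        case True
        have "insert x X = A"
        proof (rule connected_inD[OF Suc.prems(1)])
          show "insert x X \<subseteq> A" using that(1) x(1) by blast
          show "x \<in> insert x X" by simp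
          show "w \<in> insert x X" if "v \<in> insert x X" "w \<in> A" "adjacent G v w" for v w
            using that only[of w] True X by blast
        qed
        then show ?thesis using that(1) by blast
      next
        case False
        obtain v where v: "v \<in> X" using X by blast
        have "X = A"
        proof (rule connected_inD[OF Suc.prems(1)])
          show "X \<subseteq> A" using that(1) by blast
          show "v \<in> X" by (fact v)
          show "w \<in> X" if w: "v \<in> X" "w \<in> A" "adjacent G v w" for v w
          proof -
            have "v \<in> A" "v \<noteq> y" using w(1) \<open>X \<subseteq> ?A\<close> False by auto
            then have "w \<noteq> x" using only[of v] w(3) adjacent_sym by metis
            then show ?thesis using X w by blast
          qed
        qed
        then show ?thesis using that(1) x(1) by blast
      qed
    qed
    moreover have "card (nbrs G ?A v) \<le> 2" if "v \<in> ?A" for v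
      using Suc.prems(2) that card_mono[OF fin[of v], of "nbrs G A v - {x}"] unfolding nbrs
      by (meson Diff_subset DiffD1 le_trans)
    moreover have "n = card ?A" using Suc.hyps(2) x(1) finA by simp
    ultimately have IH: "card (ends ?A) \<le> 2" using Suc.hyps(1)[of ?A] by (simp add: ends_def)
    have fe: "finite (ends ?A)" using finA by (simp add: ends_def)
    have xy': "x \<in> nbrs G A y" using x(1) y(2) adjacent_sym by (fastforce simp: nbrs_def)
    have sub: "ends A - {y} \<subseteq> insert x (ends ?A - {y})"
    proof
      fix v assume v: "v \<in> ends A - {y}"
      then have "v = x \<or> x \<notin> nbrs G A v"
        using only[of v] adjacent_sym unfolding nbrs_def ends_def by fastforce
      then show "v \<in> insert x (ends ?A - {y})" using v by (auto simp: ends_def nbrs)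
    qed
    show ?thesis
    proof (cases "y \<in> ends A")
      case False
      have "card (nbrs G A y - {x}) \<le> 1" using Suc.prems(2) y(1) xy' fin[of y] by fastforce
      then have "y \<in> ends ?A" using y(1) xy by (auto simp: ends_def nbrs)
      then have "card (ends ?A - {y}) \<le> 1" using IH fe by simp
      moreover have "card (ends A) \<le> card (insert x (ends ?A - {y}))"
        using sub False fe by (intro card_mono) auto
      moreover have "card (insert x (ends ?A - {y})) \<le> Suc (card (ends ?A - {y}))"
        by (rule card_insert_le_m1) simp_all
      ultimately show ?thesis by linarith
    next
      case True
      \<comment> \<open>two adjacent vertices of degree one are a whole component\<close>
      then have "nbrs G A y = {x}"
        using xy' fin[of y] unfolding ends_def
        by (metis (mono_tags, lifting) card_0_eq card_1_singletonE empty_iff le_antisym less_one mem_Collect_eq not_le singletonD)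
      then have only': "v = x" if "v \<in> A" "adjacent G y v" for v using that unfolding nbrs_def by blast
      have "{x, y} = A"
      proof (rule connected_inD[OF Suc.prems(1), of _ x])
        show "{x, y} \<subseteq> A" using x y by blast
        show "w \<in> {x, y}" if "v \<in> {x, y}" "w \<in> A" "adjacent G v w" for v w
          using that only only' by blast
      qed simp
      then have "card A = 2" using xy by (metis card_2_iff)
      then show ?thesis using card_mono[OF finA, of "ends A"] by (auto simp: ends_def)
    qed
  qed
  then show ?case by (simp add: ends_def)
qed

lemma three_distinct:
  assumes "\<not> card A \<le> 2"
  obtains x y z where "x \<in> A" "y \<in> A" "z \<in> A" "x \<noteq> y" "x \<noteq> z" "y \<noteq> z"
proof -
  obtain T where T: "T \<subseteq> A" "card T = 3"
    using assms obtain_subset_with_card_n[of 3 A] by auto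
  then obtain x y z where "T = {x, y, z}" "x \<noteq> y" "y \<noteq> z" "x \<noteq> z" by (auto simp: card_3_iff)
  then show thesis using T(1) that[of x y z] by simp
qed

text \<open>
  Two neighbours of \<open>s\<close> in \<open>A\<close> are adjacent, since otherwise they form a claw with a neighbour of
  \<open>s\<close> in \<open>B\<close>.  Then that neighbour completes a paw.  If K3 + P1 is forbidden, all of \<open>B\<close> is adjacent
  to \<open>s\<close>, so \<open>B\<close> is a clique, and three of its vertices form K3 + P1 with \<open>x\<close>.
\<close>

lemma one_neighbour_if_claw_free:
  assumes G: "simple_graph G" and pair: "full_pair G S A B"
    and claw: "\<not> emb claw G" and F: "\<not> emb paw G \<or> \<not> emb K3_P1 G" and B: "\<not> card B \<le> 2"
    and s: "s \<in> S" and x: "x \<in> A" "adjacent G s x" and y: "y \<in> A" "adjacent G s y"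
  shows "x = y"
proof (rule ccontr)
  assume ne: "x \<noteq> y"
  note p = full_pairD[OF pair]
  obtain b where b: "b \<in> B" "adjacent G s b" using p(14) s by blast
  have V: "s \<in> verts G" "x \<in> verts G" "y \<in> verts G" using s x y p(6,7) by blast+
  have VB: "c \<in> verts G" "\<not> adjacent G x c" "\<not> adjacent G y c" "x \<noteq> c" "y \<noteq> c" "s \<noteq> c" if "c \<in> B" for c
    using that p(8) p(15)[OF x(1)] p(15)[OF y(1)] p(19)[OF x(1)] p(19)[OF y(1)] p(18)[OF _ s]
    by blast+
  note d = ne p(17)[OF x(1) s] p(17)[OF y(1) s]
  have xy: "adjacent G x y"
  proof (rule ccontr)
    assume "\<not> adjacent G x y"
    then have "emb claw G"
      by (intro emb_clawI[OF G, of s x y b]) (use V VB[OF b(1)] d x y b in auto)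
    with claw show False ..
  qed
  have "emb paw G"
    by (rule emb_pawI[OF G, of s x y b]) (use V VB[OF b(1)] d xy x y b in auto)
  with F have K: "\<not> emb K3_P1 G" by blast
  \<comment> \<open>now every vertex of \<open>B\<close> is adjacent to \<open>s\<close>, so \<open>B\<close> is a clique that contains a triangle\<close>
  have sB: "adjacent G s c" if "c \<in> B" for c
  proof (rule ccontr)
    assume "\<not> adjacent G s c"
    then have "emb K3_P1 G"
      by (intro emb_K3_P1I[OF G, of s x y c]) (use V VB[OF that] d xy x y in auto)
    with K show False ..
  qed
  have clB: "adjacent G c c'" if "c \<in> B" "c' \<in> B" "c \<noteq> c'" for c c'
  proof (rule ccontr)
    assume "\<not> adjacent G c c'"
    then have "emb claw G"
      by (intro emb_clawI[OF G, of s x c c'])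
        (use V VB[OF that(1)] VB[OF that(2)] d x that(3) sB[OF that(1)] sB[OF that(2)] in auto)
    with claw show False ..
  qed
  obtain c1 c2 c3 where c: "c1 \<in> B" "c2 \<in> B" "c3 \<in> B" "c1 \<noteq> c2" "c1 \<noteq> c3" "c2 \<noteq> c3"
    using B by (rule three_distinct)
  have "emb K3_P1 G"
    by (rule emb_K3_P1I[OF G, of c1 c2 c3 x])
      (use V VB[OF c(1)] VB[OF c(2)] VB[OF c(3)] c clB in \<open>auto dest: adjacent_sym\<close>)
  with K show False ..
qed

text \<open>
  If both components have at least three vertices, every \<open>s\<close> in \<open>S\<close> has a single neighbour in
  \<open>A\<close>, different vertices of \<open>S\<close> have different neighbours, and these neighbours have degree at
  most one inside \<open>A\<close>.  As \<open>A\<close> contains neither a claw nor a triangle, it has maximum degree two.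
  So \<open>S\<close> injects into the at most two ends of \<open>A\<close>.
\<close>

lemma claw_free_small:
  assumes G: "simple_graph G" and pair: "full_pair G S A B"
    and claw: "\<not> emb claw G" and F: "\<not> emb paw G \<or> \<not> emb K3_P1 G"
  shows "card A \<le> 2 \<or> card B \<le> 2 \<or> card S \<le> 2"
proof (rule ccontr)
  assume "\<not> ?thesis"
  then have A: "\<not> card A \<le> 2" and B: "\<not> card B \<le> 2" and S: "\<not> card S \<le> 2" by auto
  note p = full_pairD[OF pair]
  note oneA = one_neighbour_if_claw_free[OF G pair claw F B]
  note oneB = one_neighbour_if_claw_free[OF G full_pair_sym[OF pair] claw F A]
  obtain b0 where b0: "b0 \<in> B" using p(10) by blast
  have VA: "a \<in> verts G" if "a \<in> A" for a using that p(7) by blast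
  have VB: "b \<in> verts G" if "b \<in> B" for b using that p(8) by blast
  have VS: "s \<in> verts G" if "s \<in> S" for s using that p(6) by blast
  have inner: "\<not> (adjacent G x y \<and> adjacent G x z \<and> adjacent G y z)"
    if "\<not> emb K3_P1 G" and a: "x \<in> A" "y \<in> A" "z \<in> A" for x y z
  proof
    assume t: "adjacent G x y \<and> adjacent G x z \<and> adjacent G y z"
    have "emb K3_P1 G"
      by (rule emb_K3_P1I[OF G, of x y z b0])
        (use t a[THEN VA] VB[OF b0] a[THEN p(15), OF b0] a[THEN p(19), OF b0]
          adjacent_verts(3)[OF G] in auto)
    with that(1) show False ..
  qed
  have oneS: "s = t" if x: "x \<in> A" and s: "s \<in> S" "adjacent G s x" and t: "t \<in> S" "adjacent G t x" for x s t
  proof (rule ccontr)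
    assume ne: "s \<noteq> t"
    have "A \<noteq> {x}" using A by auto
    then obtain y where y: "y \<in> A" "adjacent G x y" using connected_in_neighbour[OF p(1) x] by blast
    have xy: "x \<noteq> y" using adjacent_verts(3)[OF G y(2)] .
    have ny: "\<not> adjacent G s y" "\<not> adjacent G t y"
      using oneA[OF s(1) x s(2) y(1)] oneA[OF t(1) x t(2) y(1)] xy by auto
    note xs = adjacent_sym[OF s(2)] and xt = adjacent_sym[OF t(2)]
    note d = ne xy p(17)[OF x s(1)] p(17)[OF x t(1)] p(17)[OF y(1) s(1)] p(17)[OF y(1) t(1)]
    have st: "adjacent G s t"
    proof (rule ccontr)
      assume "\<not> adjacent G s t"
      then have "emb claw G"
        by (intro emb_clawI[OF G, of x s t y])
          (use VA[OF x] VA[OF y(1)] VS[OF s(1)] VS[OF t(1)] d xs xt y ny in auto)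
      with claw show False ..
    qed
    have "emb paw G"
      by (rule emb_pawI[OF G, of x s t y])
        (use VA[OF x] VA[OF y(1)] VS[OF s(1)] VS[OF t(1)] d xs xt y ny st in auto)
    with F have K: "\<not> emb K3_P1 G" by blast
    have "adjacent G s b \<or> adjacent G t b" if b: "b \<in> B" for b
    proof (rule ccontr)
      assume "\<not> ?thesis"
      then have "emb K3_P1 G"
        by (intro emb_K3_P1I[OF G, of x s t b])
          (use VA[OF x] VB[OF b] VS[OF s(1)] VS[OF t(1)] d xs xt st p(15)[OF x b] p(19)[OF x b]
            p(18)[OF b s(1)] p(18)[OF b t(1)] in auto)
      with K show False ..
    qed
    then show False
      using B oneB[OF s(1)] oneB[OF t(1)] by (elim three_distinct) metis
  qed
  have oneD: "y = z" if s: "s \<in> S" "adjacent G s x" and a: "x \<in> A" "y \<in> A" "z \<in> A"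
    and adj: "adjacent G x y" "adjacent G x z" for s x y z
  proof (rule ccontr)
    assume ne: "y \<noteq> z"
    have d: "x \<noteq> y" "x \<noteq> z" using adj adjacent_verts(3)[OF G] by auto
    have n: "\<not> adjacent G s y" "\<not> adjacent G s z"
      using oneA[OF s(1) a(1) s(2)] a d by blast+
    note xs = adjacent_sym[OF s(2)]
    have n': "\<not> adjacent G y s" "\<not> adjacent G z s" using n adjacent_sym by fast+
    note V = a[THEN VA] VS[OF s(1)] and d = d ne a[THEN p(17), OF s(1)]
    have yz: "adjacent G y z"
    proof (rule ccontr)
      assume "\<not> adjacent G y z"
      then have "emb claw G"
        by (intro emb_clawI[OF G, of x s y z]) (use V d xs n adj in auto)
      with claw show False ..
    qed
    have "emb paw G"
      by (rule emb_pawI[OF G, of x y z s]) (use V d xs n' adj yz in auto)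
    then show False using F inner[of x y z] a adj yz by blast
  qed
  have no_triangle: False
    if t: "{x, y, z} \<subseteq> A" "adjacent G x y" "adjacent G x z" "adjacent G y z" for x y z
  proof (cases "emb K3_P1 G")
    case False
    then show ?thesis using inner[of x y z] t by simp
  next
    case True
    then have paw: "\<not> emb paw G" using F by blast
    \<comment> \<open>in a paw-free graph, triangles spread along edges, hence to a neighbour of \<open>S\<close>\<close>
    let ?Z = "{v \<in> A. \<exists>p\<in>A. \<exists>q\<in>A. adjacent G v p \<and> adjacent G v q \<and> adjacent G p q}"
    have "?Z = A"
    proof (rule connected_inD[OF p(1)])
      show "x \<in> ?Z" using t by blast
      show "w \<in> ?Z" if v: "v \<in> ?Z" and w: "w \<in> A" "adjacent G v w" for v w
      proof -
        obtain p q where pq: "p \<in> A" "q \<in> A" "adjacent G v p" "adjacent G v q" "adjacent G p q" and "v \<in> A"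
          using v by blast
        have wv: "adjacent G w v" using adjacent_sym[OF w(2)] .
        have qp: "adjacent G q p" using adjacent_sym[OF pq(5)] .
        have "w = p \<or> w = q \<or> adjacent G w p \<or> adjacent G w q"
        proof (rule ccontr)
          assume no: "\<not> ?thesis"
          then have "\<not> adjacent G p w" "\<not> adjacent G q w" using adjacent_sym by metis+
          then have "emb paw G"
            by (intro emb_pawI[OF G, of v p q w])
              (use no w pq \<open>v \<in> A\<close> VA adjacent_verts(3)[OF G] in auto)
          with paw show False ..
        qed
        then show ?thesis using w(1) wv pq qp \<open>v \<in> A\<close> by blast
      qed
    qed blast
    moreover obtain s where "s \<in> S" using S by (metis card.empty equals0I le0)
    then obtain a where "a \<in> A" "adjacent G s a" using p(13) by blast
    ultimately obtain p q where "p \<in> A" "q \<in> A" "adjacent G a p" "adjacent G a q" "adjacent G p q"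
      by blast
    then show False
      using oneD[OF \<open>s \<in> S\<close> \<open>adjacent G s a\<close> \<open>a \<in> A\<close>, of p q] adjacent_verts(3)[OF G] by blast
  qed
  have finA: "finite A" using finite_connected_in[OF G p(1)] .
  have deg: "card (nbrs G A x) \<le> 2" if x: "x \<in> A" for x
  proof (rule ccontr)
    assume "\<not> ?thesis"
    then obtain u v w where "u \<in> nbrs G A x" "v \<in> nbrs G A x" "w \<in> nbrs G A x"
      and ne: "u \<noteq> v" "u \<noteq> w" "v \<noteq> w" by (rule three_distinct)
    then have a: "u \<in> A" "v \<in> A" "w \<in> A" and adj: "adjacent G x u" "adjacent G x v" "adjacent G x w"
      by (auto simp: nbrs_def)
    have n: "\<not> adjacent G u v" "\<not> adjacent G u w" "\<not> adjacent G v w"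
      using no_triangle[of x u v] no_triangle[of x u w] no_triangle[of x v w] a x adj by auto
    have "emb claw G"
      by (rule emb_clawI[OF G, of x u v w])
        (use x a[THEN VA] VA[OF x] adj n ne adjacent_verts(3)[OF G] in auto)
    with claw show False ..
  qed
  let ?ends = "{x \<in> A. card (nbrs G A x) \<le> 1}"
  obtain f where f: "\<And>s. s \<in> S \<Longrightarrow> f s \<in> A \<and> adjacent G s (f s)" using p(13) by metis
  have "inj_on f S" using oneS f unfolding inj_on_def by metis
  moreover have "f ` S \<subseteq> ?ends"
  proof
    fix x assume "x \<in> f ` S"
    then obtain s where s: "s \<in> S" "x \<in> A" "adjacent G s x" using f by blast
    have "card (nbrs G A x) \<le> 1"
      using oneD[OF s(1,3,2)] finA by (subst card_le_Suc0_iff_eq[unfolded One_nat_def[symmetric]]) (auto simp: nbrs_def)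
    with s(2) show "x \<in> ?ends" by blast
  qed
  moreover have "finite ?ends" using finA by simp
  ultimately have "card S \<le> card ?ends" by (rule card_inj_on_le)
  also have "\<dots> \<le> 2" using card_ends_le_2[OF G p(1)] deg by blast
  finally show False using S by blast
qed

lemma described_if_claw_free:
  assumes G: "simple_graph G" and pair: "full_pair G S A B"
    and "\<not> emb claw G" and "\<not> emb paw G \<or> \<not> emb K3_P1 G"
  shows "described 2 G S"
  using claw_free_small[OF assms] described_if_small_side[OF G pair, of 2]
    described_if_small_side[OF G full_pair_sym[OF pair], of 2] full_pairD(6)[OF pair]
  unfolding described_def by blast

section \<open>Forbidding the four-cycle\<close>

definition independent :: "'v graph \<Rightarrow> 'v set \<Rightarrow> bool" where
  "independent G I \<longleftrightarrow> (\<forall>x\<in>I. \<forall>y\<in>I. \<not> adjacent G x y)"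

text \<open>
  If two vertices outside a clique \<open>Q\<close> have incomparable neighbourhoods in \<open>Q\<close>, then they are not
  adjacent, for otherwise there is a C4.  Thus the inclusion-minimal neighbourhoods come from an
  independent set, there are at most \<open>k\<close> of them, and one point from each hits all neighbourhoods.
\<close>

lemma clique_hitting_set:
  assumes G: "simple_graph G" and C4: "\<not> emb C4 G" and Q: "clique G Q" "Q \<subseteq> verts G"
    and X: "X \<subseteq> verts G" "X \<inter> Q = {}" and ind: "\<And>I. I \<subseteq> X \<Longrightarrow> independent G I \<Longrightarrow> card I \<le> k"
  shows "\<exists>T\<subseteq>Q. card T \<le> k \<and> (\<forall>x\<in>X. (\<exists>q\<in>Q. adjacent G x q) \<longrightarrow> (\<exists>t\<in>T. adjacent G x t))"
proof -
  have finX: "finite X" using G X(1) finite_subset by (auto simp: simple_graph_def)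
  let ?N = "\<lambda>x. nbrs G Q x"
  define F where "F = ?N ` X - {{}}"
  define M where "M = {m \<in> F. \<forall>m'\<in>F. m' \<subseteq> m \<longrightarrow> m = m'}"
  have finF: "finite F" unfolding F_def using finX by simp
  have MF: "M \<subseteq> F" unfolding M_def by blast
  have "\<forall>m\<in>M. \<exists>x\<in>X. ?N x = m" using MF unfolding F_def by blast
  then obtain r where r: "\<And>m. m \<in> M \<Longrightarrow> r m \<in> X" "\<And>m. m \<in> M \<Longrightarrow> ?N (r m) = m" by metis
  obtain t where t: "\<And>m. m \<in> M \<Longrightarrow> t m \<in> m"
  proof -
    have "\<forall>m\<in>M. \<exists>q. q \<in> m" using MF unfolding F_def by blast
    then show thesis using that by metis
  qed
  have "\<not> adjacent G (r m) (r n)" if m: "m \<in> M" and n: "n \<in> M" for m n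
  proof (cases "m = n")
    case True
    then show ?thesis using adjacent_irrefl[OF G] by simp
  next
    case False
    then have "\<not> m \<subseteq> n" "\<not> n \<subseteq> m" using m n MF unfolding M_def by auto
    then obtain p q where pq: "p \<in> m" "p \<notin> n" "q \<in> n" "q \<notin> m" by blast
    have p: "p \<in> Q" "adjacent G (r m) p" "\<not> adjacent G (r n) p"
      using pq(1,2) r(2)[OF m] r(2)[OF n] unfolding nbrs_def by auto
    have q: "q \<in> Q" "adjacent G (r n) q" "\<not> adjacent G (r m) q"
      using pq(3,4) r(2)[OF m] r(2)[OF n] unfolding nbrs_def by auto
    have V: "r m \<in> verts G" "r n \<in> verts G" "p \<in> verts G" "q \<in> verts G"
      using r(1)[OF m] r(1)[OF n] p(1) q(1) X(1) Q(2) by blast+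
    have ne: "p \<noteq> q" "r m \<noteq> p" "r m \<noteq> q" "r n \<noteq> p" "r n \<noteq> q" "r m \<noteq> r n"
      using pq p(1) q(1) r(1)[OF m] r(1)[OF n] X(2) p(2,3) by auto
    have pq: "adjacent G p q" using Q(1) p(1) q(1) ne(1) unfolding clique_def by blast
    show ?thesis
    proof
      assume a: "adjacent G (r m) (r n)"
      have n: "\<not> adjacent G p (r n)" using p(3) adjacent_sym by fast
      have "emb C4 G"
        by (rule emb_C4I[OF G, of "r m" p q "r n"])
          (use V ne pq p(2) q(3) a n adjacent_sym[OF q(2)] in auto)
      with C4 show False ..
    qed
  qed
  then have "independent G (r ` M)" unfolding independent_def by blast
  moreover have "r ` M \<subseteq> X" using r(1) by blast
  ultimately have "card (r ` M) \<le> k" by (intro ind)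
  moreover have "inj_on r M" using r(2) by (metis inj_onI)
  ultimately have "card M \<le> k" by (simp add: card_image)
  then have card: "card (t ` M) \<le> k"
    using card_image_le[of M t] finite_subset[OF MF finF] by linarith
  have sub: "t ` M \<subseteq> Q"
    using t MF unfolding F_def nbrs_def by fastforce
  have hit: "\<exists>u\<in>t ` M. adjacent G x u" if x: "x \<in> X" "\<exists>q\<in>Q. adjacent G x q" for x
  proof -
    obtain q where "q \<in> ?N x" using x(2) by (auto simp: nbrs_def)
    then have "?N x \<in> F" using x(1) unfolding F_def by (metis Diff_iff empty_iff imageI singletonD)
    from finite_has_minimal2[OF finF this] obtain m
      where m: "m \<in> F" "m \<subseteq> ?N x" "\<forall>m'\<in>F. m' \<subseteq> m \<longrightarrow> m = m'" by (elim bexE conjE)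
    then have "m \<in> M" unfolding M_def by simp
    then have "t m \<in> ?N x" using t[of m] m(2) by (metis subsetD)
    then have "adjacent G x (t m)" by (simp add: nbrs_def)
    with \<open>m \<in> M\<close> show ?thesis by blast
  qed
  show ?thesis
    by (intro exI[of _ "t ` M"] conjI ballI impI sub card) (rule hit)
qed

text \<open>
  Suppose \<open>S\<close> has four independent vertices.  Without P2 + 2P1, a vertex adjacent to one of them
  misses at most one of them, so a vertex of \<open>A\<close> and one of \<open>B\<close> have two common neighbours among the
  four: a C4.  Without P3 + P1, a vertex adjacent to two of them is adjacent to all, and each
  clique contains such a vertex; again this gives a C4.
\<close>

lemma independent_le_3:
  assumes G: "simple_graph G" and pair: "full_pair G S A B" and C4: "\<not> emb C4 G"
    and F: "\<not> emb P2_2P1 G \<or> \<not> emb P3_P1 G" and cl: "clique G A" "clique G B"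
    and I: "I \<subseteq> S" "independent G I"
  shows "card I \<le> 3"
proof (rule ccontr)
  assume "\<not> ?thesis"
  then obtain s1 s2 s3 s4 where sI: "{s1, s2, s3, s4} \<subseteq> I" and ne: "distinct [s1, s2, s3, s4]"
    by (rule four_distinct)
  note p = full_pairD[OF pair]
  let ?S = "{s1, s2, s3, s4}"
  have "?S \<subseteq> S" "S \<subseteq> verts G" using sI I(1) p(6) by auto
  then have SS: "s \<in> S" "s \<in> verts G" if "s \<in> ?S" for s using that by blast+
  have nS: "\<not> adjacent G s t" if "s \<in> ?S" "t \<in> ?S" for s t
    using that sI I(2) unfolding independent_def by blast
  have AB: "x \<in> verts G" "x \<notin> S" if "x \<in> A \<union> B" for x using that p(4,5,7,8) by blast+
  have no_C4: False if "a \<in> A" "b \<in> B" "s \<in> ?S" "t \<in> ?S" "s \<noteq> t"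
      "adjacent G s a" "adjacent G t a" "adjacent G s b" "adjacent G t b" for a b s t
  proof -
    have "emb C4 G"
      by (rule emb_C4I[OF G, of s a t b])
        (use that SS[OF that(3)] SS[OF that(4)] nS[OF that(3,4)] p(7,8) p(15)[OF that(1,2)]
          p(17)[OF that(1)] p(18)[OF that(2)] p(19)[OF that(1,2)] adjacent_sym[OF that(7)]
          in auto)
    with C4 show False ..
  qed
  show False
  proof (cases "emb P2_2P1 G")
    case False
    have miss1: "adjacent G t x \<or> adjacent G u x"
      if "x \<in> A \<union> B" "s \<in> ?S" "adjacent G s x" "t \<in> ?S" "u \<in> ?S" "distinct [s, t, u]" for x s t u
    proof (rule ccontr)
      assume no: "\<not> ?thesis"
      have n: "\<not> adjacent G x t" "\<not> adjacent G x u" using no adjacent_sym by metis+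
      have x: "x \<in> verts G" "x \<noteq> t" "x \<noteq> u" "x \<noteq> s"
        using AB[OF that(1)] SS(1)[OF that(2)] SS(1)[OF that(4)] SS(1)[OF that(5)] by auto
      have "emb P2_2P1 G"
        by (rule emb_P2_2P1I[OF G, of s x t u])
          (use that x n SS nS[OF that(2,4)] nS[OF that(2,5)] nS[OF that(4,5)] in auto)
      with False show False ..
    qed
    obtain a where a: "a \<in> A" "adjacent G s1 a" using p(13)[of s1] SS(1)[of s1] by auto
    obtain b where b: "b \<in> B" "adjacent G s1 b" using p(14)[of s1] SS(1)[of s1] by auto
    have m: "adjacent G t x \<or> adjacent G u x"
      if "x = a \<or> x = b" "t \<in> {s2, s3, s4}" "u \<in> {s2, s3, s4}" "t \<noteq> u" for x t u
      using miss1[of x s1 t u] that a b ne by auto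
    have c: False if "t \<in> {s2, s3, s4}" "adjacent G t a" "adjacent G t b" for t
      using no_C4[OF a(1) b(1), of s1 t] a(2) b(2) that ne by auto
    show False
      using m[of a s2 s3] m[of a s2 s4] m[of a s3 s4] m[of b s2 s3] m[of b s2 s4] m[of b s3 s4]
        c[of s2] c[of s3] c[of s4] ne by auto
  next
    case True
    then have P3P1: "\<not> emb P3_P1 G" using F by blast
    let ?T = "{s1, s2, s3}"
    have all: "adjacent G u x"
      if "x \<in> A \<union> B" "s \<in> ?S" "t \<in> ?S" "u \<in> ?S" "distinct [s, t, u]" "adjacent G s x" "adjacent G t x" for x s t u
    proof (rule ccontr)
      assume no: "\<not> ?thesis"
      have x: "x \<in> verts G" "x \<noteq> t" "x \<noteq> u" "x \<noteq> s"
        using AB[OF that(1)] SS(1)[OF that(2)] SS(1)[OF that(3)] SS(1)[OF that(4)] by auto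
      have "\<not> adjacent G x u" using no adjacent_sym by metis
      then have "emb P3_P1 G"
        by (intro emb_P3_P1I[OF G, of s x t u])
          (use that x SS nS[OF that(2,3)] nS[OF that(2,4)] nS[OF that(3,4)] adjacent_sym[OF that(7)] in auto)
      with P3P1 show False ..
    qed
    \<comment> \<open>without a vertex adjacent to all three, the clique and three vertices contain P3 + P1\<close>
    have common: "\<exists>x\<in>D. \<forall>s\<in>?T. adjacent G s x"
      if D: "clique G D" "D \<subseteq> A \<union> B" "\<And>s. s \<in> S \<Longrightarrow> \<exists>x\<in>D. adjacent G s x" for D
    proof (rule ccontr)
      assume no: "\<not> ?thesis"
      have only: "\<not> adjacent G t x" if "x \<in> D" "s \<in> ?T" "adjacent G s x" "t \<in> ?T" "t \<noteq> s" for x s t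
      proof
        assume t: "adjacent G t x"
        have "adjacent G u x" if "u \<in> ?T" for u
          using all[of x s t u] that \<open>x \<in> D\<close> D(2) \<open>s \<in> ?T\<close> \<open>t \<in> ?T\<close> \<open>t \<noteq> s\<close> t \<open>adjacent G s x\<close> by auto
        then show False using no \<open>x \<in> D\<close> by blast
      qed
      obtain x where x: "x \<in> D" "adjacent G s1 x" using D(3)[of s1] SS(1)[of s1] by auto
      obtain y where y: "y \<in> D" "adjacent G s2 y" using D(3)[of s2] SS(1)[of s2] by auto
      have n: "\<not> adjacent G s1 y" "\<not> adjacent G s3 y" "\<not> adjacent G s3 x"
        using only[OF x(1) _ x(2)] only[OF y(1) _ y(2)] ne by auto
      then have xy: "x \<noteq> y" using x(2) by blast
      then have "adjacent G x y" using D(1) x(1) y(1) unfolding clique_def by blast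
      have DV: "D \<subseteq> verts G" "D \<inter> S = {}" using D(2) p(4,5,7,8) by blast+
      have V: "v \<in> verts G" "v \<noteq> s1" "v \<noteq> s3" if "v \<in> D" for v
        using that DV SS(1)[of s1] SS(1)[of s3] by auto
      have "\<not> adjacent G x s3" "\<not> adjacent G y s3" using n adjacent_sym by metis+
      then have "emb P3_P1 G"
        by (intro emb_P3_P1I[OF G, of s1 x y s3])
          (use V[OF x(1)] V[OF y(1)] SS[of s1] SS[of s3] n x xy \<open>adjacent G x y\<close> ne nS[of s1 s3] in auto)
      with P3P1 show False ..
    qed
    obtain a where "a \<in> A" "\<forall>s\<in>?T. adjacent G s a"
      using common[OF cl(1) _ p(13)] by auto
    moreover obtain b where "b \<in> B" "\<forall>s\<in>?T. adjacent G s b"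
      using common[OF cl(2) _ p(14)] by auto
    ultimately show False using no_C4[of a b s1 s2] ne by simp
  qed
qed

text \<open>
  Unless one component is a single vertex, each contains an edge.  A path on three vertices in one of
  them then yields both P2 + 2P1 and P3 + P1, so both components are cliques and three points of
  each reach all of \<open>S\<close>.
\<close>

lemma described_if_C4_free:
  assumes G: "simple_graph G" and pair: "full_pair G S A B" and C4: "\<not> emb C4 G"
    and F: "\<not> emb P2_2P1 G \<or> \<not> emb P3_P1 G"
  shows "described 3 G S"
proof -
  note p = full_pairD[OF pair]
  obtain a b where ab: "a \<in> A" "b \<in> B" using p(9,10) by blast
  show ?thesis
  proof (cases "A = {a} \<or> B = {b}")
    case True
    then show ?thesis
      using described_if_small_side[OF G pair, of 3]
        described_if_small_side[OF G full_pair_sym[OF pair], of 3] by auto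
  next
    case False
    have cl: "clique G A" if pair: "full_pair G S A B" and B: "y \<in> B" "B \<noteq> {y}" for A B y
    proof (rule ccontr)
      assume "\<not> clique G A"
      note p = full_pairD[OF pair]
      obtain u v w where uvw: "{u, v, w} \<subseteq> A" "u \<noteq> w" "adjacent G u v" "adjacent G v w" "\<not> adjacent G u w"
        by (rule connected_in_path3[OF p(1) \<open>\<not> clique G A\<close>])
      obtain z where z: "z \<in> B" "adjacent G y z" using connected_in_neighbour[OF p(2) B] by blast
      have A: "u \<in> A" "v \<in> A" "w \<in> A" using uvw(1) by auto
      have V: "u \<in> verts G" "v \<in> verts G" "w \<in> verts G" "y \<in> verts G" "z \<in> verts G"
        using A B(1) z(1) p(7,8) by blast+
      note n = A[THEN p(15), OF B(1)] A[THEN p(15), OF z(1)] A[THEN p(16), OF B(1)] A[THEN p(16), OF z(1)]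
      have ne: "u \<noteq> v" "v \<noteq> w" "y \<noteq> z" using adjacent_verts(3)[OF G] uvw z by auto
      note ne = ne uvw(2) A[THEN p(19), OF B(1)] A[THEN p(19), OF z(1)]
      have "emb P2_2P1 G" by (rule emb_P2_2P1I[OF G, of y z u w]) (use V n ne uvw z in auto)
      moreover have "emb P3_P1 G" by (rule emb_P3_P1I[OF G, of u v w y]) (use V n ne uvw in auto)
      ultimately show False using F by blast
    qed
    have clA: "clique G A" and clB: "clique G B"
      using cl[OF pair ab(2)] cl[OF full_pair_sym[OF pair] ab(1)] False by blast+
    note ind = independent_le_3[OF G pair C4 F clA clB]
    obtain T where "T \<subseteq> A" "card T \<le> 3" "\<forall>x\<in>S. (\<exists>q\<in>A. adjacent G x q) \<longrightarrow> (\<exists>t\<in>T. adjacent G x t)"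
      using clique_hitting_set[OF G C4 clA p(7,6) _ ind] p(4) by blast
    moreover obtain U where "U \<subseteq> B" "card U \<le> 3" "\<forall>x\<in>S. (\<exists>q\<in>B. adjacent G x q) \<longrightarrow> (\<exists>t\<in>U. adjacent G x t)"
      using clique_hitting_set[OF G C4 clB p(8,6) _ ind] p(5) by blast
    ultimately show ?thesis
      using p(13,14) by (intro described_if_dominated[OF G pair, of T 3 U]) simp_all
  qed
qed

text \<open>
  Fix an edge \<open>v u\<close>.  The common neighbours of \<open>v\<close> and \<open>u\<close> form a clique because there is no diamond;
  the neighbours of \<open>v\<close> that miss \<open>u\<close>, and the vertices that miss \<open>v\<close>, form cliques because there
  are no three independent vertices.
\<close>

lemma three_cliques_cover:
  assumes G: "simple_graph G" and diamond: "\<not> emb diamond G" and D: "D \<subseteq> verts G"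
    and no3: "\<And>x y z. {x, y, z} \<subseteq> D \<Longrightarrow> distinct [x, y, z] \<Longrightarrow> \<not> independent G {x, y, z}"
  shows "\<exists>P Q R. D = P \<union> Q \<union> R \<and> clique G P \<and> clique G Q \<and> clique G R"
proof (cases "\<exists>v\<in>D. \<exists>u\<in>D. adjacent G v u")
  case False
  have "clique G D \<or> (\<exists>x y. D = {x, y})"
  proof (rule ccontr)
    assume no: "\<not> ?thesis"
    then obtain x y where xy: "x \<in> D" "y \<in> D" "x \<noteq> y" unfolding clique_def by blast
    then obtain z where z: "z \<in> D" "z \<noteq> x" "z \<noteq> y" using no by blast
    have "independent G {x, y, z}" using False xy z unfolding independent_def by blast
    then show False using no3[of x y z] xy z by auto
  qed
  then show ?thesis
  proof
    assume "clique G D"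
    then show ?thesis by (intro exI[of _ D]) (simp add: clique_def)
  next
    assume "\<exists>x y. D = {x, y}"
    then obtain x y where "D = {x, y}" by blast
    then show ?thesis
      by (intro exI[of _ "{x}"] exI[of _ "{y}"] exI[of _ "{}"]) (auto simp: clique_def)
  qed
next
  case True
  then obtain v u where v: "v \<in> D" and u: "u \<in> D" "adjacent G v u" by blast
  have cot: "adjacent G x y" if "{x, y, z} \<subseteq> D" "\<not> adjacent G z x" "\<not> adjacent G z y" "distinct [x, y, z]" for x y z
    using no3[of x y z] that adjacent_irrefl[OF G] adjacent_commute[of G] unfolding independent_def by auto
  let ?P = "{w \<in> D. (w = v \<or> adjacent G v w) \<and> (w = u \<or> adjacent G u w)}"
  let ?Q = "{w \<in> D. adjacent G v w \<and> w \<noteq> u \<and> \<not> adjacent G u w}"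
  let ?R = "{w \<in> D. w \<noteq> v \<and> \<not> adjacent G v w}"
  have "D = ?P \<union> ?Q \<union> ?R" using v u adjacent_sym[OF u(2)] by blast
  moreover have "clique G ?P"
    unfolding clique_def
  proof (intro ballI impI)
    fix x y assume x: "x \<in> ?P" and y: "y \<in> ?P" and ne: "x \<noteq> y"
    show "adjacent G x y"
    proof (cases "x \<in> {u, v} \<or> y \<in> {u, v}")
      case True
      then show ?thesis using x y ne u(2) adjacent_sym by fastforce
    next
      case False
      then have a: "adjacent G v x" "adjacent G u x" "adjacent G v y" "adjacent G u y" using x y by auto
      show ?thesis
      proof (rule ccontr)
        assume "\<not> ?thesis"
        then have "emb diamond G"
          by (intro emb_diamondI[OF G, of x y v u])
            (use False ne x y v u D a[THEN adjacent_sym] adjacent_verts(3)[OF G u(2)] in auto)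
        with diamond show False ..
      qed
    qed
  qed
  moreover have "clique G ?Q"
    unfolding clique_def using cot[of _ _ u] u(1) by auto
  moreover have "clique G ?R"
    unfolding clique_def using cot[of _ _ v] v by auto
  ultimately show ?thesis by blast
qed

text \<open>
  Three independent vertices in one component and a vertex of the other would form 4P1.  So each
  component is covered by three cliques, and each clique contributes at most three hitting points.
\<close>

lemma described_if_C4_diamond_free:
  assumes G: "simple_graph G" and pair: "full_pair G S A B"
    and C4: "\<not> emb C4 G" and diamond: "\<not> emb diamond G" and FourP1: "\<not> emb FourP1 G"
  shows "described 9 G S"
proof -
  have ind: "card I \<le> 3" if I: "I \<subseteq> S" "independent G I" for I
  proof (rule ccontr)
    assume "\<not> ?thesis"
    then obtain x y z w where *: "{x, y, z, w} \<subseteq> I" "distinct [x, y, z, w]" by (rule four_distinct)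
    then have "{x, y, z, w} \<subseteq> verts G" using I(1) full_pairD(6)[OF pair] by blast
    then have "emb FourP1 G"
      using * I(2) unfolding independent_def by (intro emb_FourP1I[OF G, of x y z w]) simp_all
    with FourP1 show False ..
  qed
  have hit: "\<exists>T\<subseteq>D. card T \<le> 9 \<and> (\<forall>s\<in>S. \<exists>t\<in>T. adjacent G s t)" if pair: "full_pair G S D E" for D E
  proof -
    note p = full_pairD[OF pair]
    obtain e where e: "e \<in> E" using p(10) by blast
    have "\<not> independent G {x, y, z}" if "{x, y, z} \<subseteq> D" "distinct [x, y, z]" for x y z
    proof
      assume i: "independent G {x, y, z}"
      have D: "x \<in> D" "y \<in> D" "z \<in> D" using that(1) by auto
      have "emb FourP1 G"
        by (rule emb_FourP1I[OF G, of x y z e])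
          (use that(2) i e p(7,8) D D[THEN p(15), OF e] D[THEN p(19), OF e] in \<open>auto simp: independent_def\<close>)
      with FourP1 show False ..
    qed
    then obtain P Q R where D: "D = P \<union> Q \<union> R" and cl: "clique G P" "clique G Q" "clique G R"
      using three_cliques_cover[OF G diamond p(7)] by blast
    have "\<exists>T\<subseteq>C. card T \<le> 3 \<and> (\<forall>x\<in>S. (\<exists>q\<in>C. adjacent G x q) \<longrightarrow> (\<exists>t\<in>T. adjacent G x t))"
      if "clique G C" "C \<subseteq> D" for C
      by (rule clique_hitting_set[OF G C4 that(1) _ p(6) _ ind]) (use p(4,7) that(2) in blast)+
    then obtain T where T: "\<And>C. clique G C \<Longrightarrow> C \<subseteq> D \<Longrightarrow> T C \<subseteq> C \<and> card (T C) \<le> 3 \<and>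
        (\<forall>x\<in>S. (\<exists>q\<in>C. adjacent G x q) \<longrightarrow> (\<exists>t\<in>T C. adjacent G x t))" by metis
    note TP = T[OF cl(1)] and TQ = T[OF cl(2)] and TR = T[OF cl(3)]
    have sub: "P \<subseteq> D" "Q \<subseteq> D" "R \<subseteq> D" unfolding D by blast+
    have "card (T P \<union> T Q \<union> T R) \<le> 9"
      using card_Un_le[of "T P" "T Q"] card_Un_le[of "T P \<union> T Q" "T R"] TP TQ TR sub by linarith
    moreover have "T P \<union> T Q \<union> T R \<subseteq> D" using TP TQ TR sub by blast
    moreover have "\<exists>t\<in>T P \<union> T Q \<union> T R. adjacent G s t" if s: "s \<in> S" for s
    proof -
      obtain d where "d \<in> P \<union> Q \<union> R" "adjacent G s d" using p(13)[OF s] D by blast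
      then show ?thesis using TP TQ TR sub s by blast
    qed
    ultimately show ?thesis by blast
  qed
  obtain T where "T \<subseteq> A" "card T \<le> 9" "\<forall>s\<in>S. \<exists>t\<in>T. adjacent G s t" using hit[OF pair] by blast
  moreover obtain U where "U \<subseteq> B" "card U \<le> 9" "\<forall>s\<in>S. \<exists>u\<in>U. adjacent G s u"
    using hit[OF full_pair_sym[OF pair]] by blast
  ultimately show ?thesis
    by (intro described_if_dominated[OF G pair, of T 9 U]) simp_all
qed

section \<open>Graphs with exponentially many minimal separators\<close>

text \<open>
  All three constructions have the same shape: two disjoint copies of a graph \<open>H\<close>, on the even
  and on the odd numbers, and a matching that joins the two copies of each vertex in \<open>C\<close>.
\<close>

definition twin :: "nat graph \<Rightarrow> nat set \<Rightarrow> nat graph" where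
  "twin H C = \<lparr>verts = verts (H \<oplus> H), edges = edges (H \<oplus> H) \<union> (\<lambda>c. {2 * c, 2 * c + 1}) ` C\<rparr>"

lemma verts_twin: "verts (twin H C) = (\<lambda>v. 2 * v) ` verts H \<union> (\<lambda>v. 2 * v + 1) ` verts H"
  by (simp add: twin_def disj_union_def map_graph_def Let_def)

lemma in_verts_twin: "x \<in> verts (twin H C) \<longleftrightarrow> x div 2 \<in> verts H"
proof
  assume "x div 2 \<in> verts H"
  moreover have "x = 2 * (x div 2) \<or> x = 2 * (x div 2) + 1" by presburger
  ultimately show "x \<in> verts (twin H C)" unfolding verts_twin by blast
qed (auto simp: verts_twin)

lemma pair_in_image_iff:
  assumes "\<And>v. g (f v) = v"
  shows "{x, y} \<in> (\<lambda>e. f ` e) ` E \<longleftrightarrow> f (g x) = x \<and> f (g y) = y \<and> {g x, g y} \<in> E"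
proof
  assume "{x, y} \<in> (\<lambda>e. f ` e) ` E"
  then obtain e where e: "e \<in> E" "{x, y} = f ` e" by blast
  have "g ` {x, y} = e" unfolding e(2) image_image assms by simp
  moreover have "x \<in> f ` e" "y \<in> f ` e" using e(2) by blast+
  ultimately show "f (g x) = x \<and> f (g y) = y \<and> {g x, g y} \<in> E" using e(1) assms by auto
next
  assume "f (g x) = x \<and> f (g y) = y \<and> {g x, g y} \<in> E"
  then show "{x, y} \<in> (\<lambda>e. f ` e) ` E" by (intro image_eqI[of _ _ "{g x, g y}"]) auto
qed

lemma adjacent_twin:
  "adjacent (twin H C) x y \<longleftrightarrow>
     (if even x \<longleftrightarrow> even y then adjacent H (x div 2) (y div 2) else x div 2 = y div 2 \<and> x div 2 \<in> C)"
proof -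
  have half: "2 * (x div 2) = x \<longleftrightarrow> even x" "Suc (2 * (x div 2)) = x \<longleftrightarrow> odd x" for x :: nat
    by presburger+
  have 0: "{x, y} \<in> (\<lambda>e. (\<lambda>v. 2 * v) ` e) ` edges H \<longleftrightarrow> even x \<and> even y \<and> {x div 2, y div 2} \<in> edges H"
    by (subst pair_in_image_iff[where g = "\<lambda>v. v div 2"]) (auto simp: half)
  have 1: "{x, y} \<in> (\<lambda>e. (\<lambda>v. 2 * v + 1) ` e) ` edges H \<longleftrightarrow> odd x \<and> odd y \<and> {x div 2, y div 2} \<in> edges H"
    by (subst pair_in_image_iff[where g = "\<lambda>v. v div 2"]) (auto simp: half)
  have 2: "{x, y} \<in> (\<lambda>c. {2 * c, 2 * c + 1}) ` C \<longleftrightarrow> (even x \<noteq> even y) \<and> x div 2 = y div 2 \<and> x div 2 \<in> C"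
  proof
    assume r: "(even x \<noteq> even y) \<and> x div 2 = y div 2 \<and> x div 2 \<in> C"
    define c where "c = x div 2"
    have c: "x div 2 = c" "y div 2 = c" and parity: "even x \<noteq> even y" using r by (simp_all add: c_def)
    have "x = 2 * c \<and> y = 2 * c + 1 \<or> y = 2 * c \<and> x = 2 * c + 1"
      using div_mult_mod_eq[of x 2] div_mult_mod_eq[of y 2] parity
      unfolding c even_iff_mod_2_eq_zero by auto
    then have "{x, y} = {2 * c, 2 * c + 1}" by (elim disjE) auto
    moreover have "c \<in> C" using r unfolding c_def by blast
    ultimately show "{x, y} \<in> (\<lambda>c. {2 * c, 2 * c + 1}) ` C" by blast
  qed (auto simp: doubleton_eq_iff)
  show ?thesis
    unfolding adjacent_def twin_def disj_union_def map_graph_def Let_def using 0 1 2 by auto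
qed

lemma simple_twin:
  assumes "simple_graph H" "C \<subseteq> verts H"
  shows "simple_graph (twin H C)"
proof -
  have "e \<subseteq> verts (twin H C) \<and> card e = 2" if e: "e \<in> edges (twin H C)" for e
  proof -
    have edge: "\<exists>u v. d = {u, v} \<and> u \<noteq> v \<and> u \<in> verts H \<and> v \<in> verts H" if "d \<in> edges H" for d
    proof -
      have "d \<subseteq> verts H" "card d = 2" using assms(1) that by (auto simp: simple_graph_def)
      then show ?thesis by (auto simp: card_2_iff)
    qed
    have "\<exists>x y. e = {x, y} \<and> x \<noteq> y \<and> x div 2 \<in> verts H \<and> y div 2 \<in> verts H"
    proof -
      consider d where "d \<in> edges H" "e = (\<lambda>v. 2 * v) ` d" | d where "d \<in> edges H" "e = (\<lambda>v. 2 * v + 1) ` d"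
        | c where "c \<in> C" "e = {2 * c, 2 * c + 1}"
        using e unfolding twin_def disj_union_def map_graph_def Let_def by auto
      then show ?thesis
      proof cases
        case 1
        then show ?thesis using edge[of d] by fastforce
      next
        case 2
        then obtain u v where "d = {u, v}" "u \<noteq> v" "u \<in> verts H" "v \<in> verts H" using edge by blast
        then show ?thesis using 2 by (intro exI[of _ "2 * u + 1"] exI[of _ "2 * v + 1"]) simp
      next
        case 3
        then show ?thesis using assms(2) by (intro exI[of _ "2 * c"] exI[of _ "2 * c + 1"]) auto
      qed
    qed
    then show ?thesis by (auto simp: in_verts_twin)
  qed
  moreover have "finite (verts (twin H C))" "verts (twin H C) \<noteq> {}"
    using assms(1) by (simp_all add: verts_twin simple_graph_def)
  ultimately show ?thesis unfolding simple_graph_def by blast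
qed

lemma card_verts_twin:
  assumes "simple_graph H"
  shows "card (verts (twin H C)) = 2 * card (verts H)"
proof -
  have "card ((\<lambda>v. 2 * v) ` verts H) = card (verts H)" "card ((\<lambda>v. 2 * v + 1) ` verts H) = card (verts H)"
    by (simp_all add: card_image inj_on_def)
  moreover have "(\<lambda>v. 2 * v) ` verts H \<inter> (\<lambda>v. 2 * v + 1) ` verts H = {}"
    by auto presburger
  ultimately show ?thesis
    unfolding verts_twin using assms by (simp add: card_Un_disjoint simple_graph_def)
qed

text \<open>
  From every matching edge one end can be chosen freely.  Deleting the chosen ends cuts the matching,
  while the two copies of the connected part \<open>H - C\<close> survive.  Restoring a chosen end reconnects
  them through its matching edge, so the separator is minimal.
\<close>

lemma minimal_separator_twin:
  assumes H: "simple_graph H" and C: "C \<subseteq> verts H" and L: "connected_in H (verts H - C)"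
    and nbr: "\<And>c. c \<in> C \<Longrightarrow> \<exists>l\<in>verts H - C. adjacent H c l" and I: "I \<subseteq> C"
  shows "minimal_separator (twin H C) ((\<lambda>c. 2 * c) ` I \<union> (\<lambda>c. 2 * c + 1) ` (C - I))"
    (is "minimal_separator ?G ?S")
proof -
  let ?L = "verts H - C"
  note G = simple_twin[OF H C]
  define R where "R T x y \<longleftrightarrow> adjacent ?G x y \<and> x \<notin> T \<and> y \<notin> T" for T x y
  obtain v where v: "v \<in> ?L" using L unfolding connected_in_def by blast
  let ?a = "2 * v" and ?b = "2 * v + 1"
  have S: "x \<in> ?S \<longleftrightarrow> x div 2 \<in> C \<and> (even x \<longleftrightarrow> x div 2 \<in> I)" for x
  proof
    assume x: "x div 2 \<in> C \<and> (even x \<longleftrightarrow> x div 2 \<in> I)"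
    show "x \<in> ?S"
    proof (cases "even x")
      case True
      then have "x = 2 * (x div 2)" by simp
      with x True show ?thesis by blast
    next
      case False
      then have "x = 2 * (x div 2) + 1" by simp
      with x False show ?thesis by blast
    qed
  qed (use I in auto)
  have SL: "x \<notin> ?S" if "x div 2 \<in> ?L" for x using that S[of x] by simp
  have ab: "?a \<in> verts ?G - ?S" "?b \<in> verts ?G - ?S"
    using v SL[of ?a] SL[of ?b] by (simp_all add: in_verts_twin)
  \<comment> \<open>both copies of the connected part survive and stay connected\<close>
  have conn: "(R T)\<^sup>*\<^sup>* (2 * u + e) (2 * w + e)"
    if T: "T \<subseteq> ?S" and u: "u \<in> ?L" and w: "w \<in> ?L" and e: "e < 2" for T u w e
  proof -
    let ?X = "{w \<in> ?L. (R T)\<^sup>*\<^sup>* (2 * u + e) (2 * w + e)}"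
    have "?X = ?L"
    proof (rule connected_inD[OF L])
      show "u \<in> ?X" using u by simp
      show "y \<in> ?X" if x: "x \<in> ?X" and y: "y \<in> ?L" "adjacent H x y" for x y
      proof -
        have "even (2 * x + e) \<longleftrightarrow> even (2 * y + e)" "(2 * x + e) div 2 = x" "(2 * y + e) div 2 = y"
          using e by simp_all
        moreover have "2 * x + e \<notin> T" "2 * y + e \<notin> T"
          using SL[of "2 * x + e"] SL[of "2 * y + e"] T x y(1) e by auto
        ultimately have "R T (2 * x + e) (2 * y + e)"
          using y(2) unfolding R_def adjacent_twin by simp
        then have "(R T)\<^sup>*\<^sup>* (2 * u + e) (2 * y + e)"
          using x by (auto intro: rtranclp.rtrancl_into_rtrancl)
        then show ?thesis using y(1) by blast
      qed
    qed blast
    then have "w \<in> ?X" using w by blast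
    then show ?thesis by blast
  qed
  have "even y" if "(R ?S)\<^sup>*\<^sup>* ?a y" for y
    using that
  proof (induction rule: rtranclp_induct)
    case (step y z)
    show ?case
    proof (rule ccontr)
      assume "odd z"
      then have "y div 2 = z div 2" "y div 2 \<in> C" "y \<notin> ?S" "z \<notin> ?S"
        using step unfolding R_def adjacent_twin by auto
      then show False using S[of y] S[of z] step.IH \<open>odd z\<close> by simp
    qed
  qed simp
  then have "\<not> (R ?S)\<^sup>*\<^sup>* ?a ?b" by fastforce
  then have "component (delete_verts ?G ?S) ?a \<noteq> component (delete_verts ?G ?S) ?b"
    unfolding component_eq_iff[OF G ab] R_def .
  moreover have "x \<in> verts ?G - {?a, ?b}" if "x \<in> ?S" for x
    using that S[of x] C v by (auto simp: in_verts_twin)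
  ultimately have sep: "separator ?G ?a ?b ?S" unfolding separator_def by blast
  have "\<not> separator ?G ?a ?b T" if T: "T \<subset> ?S" for T
  proof -
    obtain s where s: "s \<in> ?S" "s \<notin> T" using T by blast
    let ?c = "s div 2"
    have c: "?c \<in> C" using s(1) S by blast
    then obtain l where l: "l \<in> ?L" "adjacent H ?c l" using nbr by blast
    have free: "2 * ?c \<notin> T \<and> 2 * ?c + 1 \<notin> T"
    proof (cases "even s")
      case True
      then have "2 * ?c = s" "2 * ?c + 1 \<notin> ?S" using s(1) S[of s] S[of "2 * ?c + 1"] by auto
      then show ?thesis using T s(2) by auto
    next
      case False
      then have "2 * ?c + 1 = s" "2 * ?c \<notin> ?S" using s(1) S[of s] S[of "2 * ?c"] by auto
      then show ?thesis using T s(2) by auto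
    qed
    have "2 * l \<notin> T" "2 * l + 1 \<notin> T" using SL[of "2 * l"] SL[of "2 * l + 1"] l(1) T by auto
    then have step: "R T (2 * l) (2 * ?c)" "R T (2 * ?c) (2 * ?c + 1)" "R T (2 * ?c + 1) (2 * l + 1)"
      using free c l(2) adjacent_sym[OF l(2)] unfolding R_def adjacent_twin by simp_all
    have "(R T)\<^sup>*\<^sup>* ?a (2 * l)" "(R T)\<^sup>*\<^sup>* (2 * l + 1) ?b"
      using conn[of T v l 0] conn[of T l v 1] T v l(1) by auto
    then have "(R T)\<^sup>*\<^sup>* ?a ?b"
      using step by (meson rtranclp.rtrancl_into_rtrancl rtranclp_trans)
    moreover have "?a \<in> verts ?G - T" "?b \<in> verts ?G - T" using ab T by auto
    ultimately show ?thesis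
      using component_eq_iff[OF G, of ?a T ?b] unfolding separator_def R_def by blast
  qed
  then have "minimal_ab_separator ?G ?a ?b ?S" unfolding minimal_ab_separator_def using sep by blast
  moreover have "\<not> adjacent ?G ?a ?b" using v by (simp add: adjacent_twin)
  ultimately show ?thesis unfolding minimal_separator_def using ab by fastforce
qed

lemma num_min_seps_twin:
  assumes H: "simple_graph H" and C: "C \<subseteq> verts H" and L: "connected_in H (verts H - C)"
    and nbr: "\<And>c. c \<in> C \<Longrightarrow> \<exists>l\<in>verts H - C. adjacent H c l"
  shows "2 ^ card C \<le> num_min_seps (twin H C)"
proof -
  let ?S = "\<lambda>I. (\<lambda>c. 2 * c) ` I \<union> (\<lambda>c. 2 * c + 1) ` (C - I)"
  have finC: "finite C" using C H finite_subset by (auto simp: simple_graph_def)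
  have "{c. 2 * c \<in> ?S I} = I" for I by auto presburger
  then have "inj_on ?S (Pow C)" by (rule inj_on_inverseI[where g = "\<lambda>S. {c. 2 * c \<in> S}"])
  moreover have "?S ` Pow C \<subseteq> {S. minimal_separator (twin H C) S}"
    using minimal_separator_twin[OF H C L nbr] by blast
  moreover have "{S. minimal_separator (twin H C) S} \<subseteq> Pow (verts (twin H C))"
    unfolding minimal_separator_def minimal_ab_separator_def separator_def by blast
  then have "finite {S. minimal_separator (twin H C) S}"
    using simple_twin[OF H C] finite_subset by (auto simp: simple_graph_def)
  ultimately have "card (Pow C) \<le> num_min_seps (twin H C)"
    unfolding num_min_seps_def by (rule card_inj_on_le)
  then show ?thesis using finC by (simp add: card_Pow)
qed

text \<open>
  The statement is for all bases \<open>c > 1\<close> at once so that the induction on the polynomial can pass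
  from \<open>c\<close> to its square root.
\<close>

lemma poly_over_power_tendsto_0:
  fixes q :: "real poly"
  assumes "1 < c"
  shows "(\<lambda>n. poly q (real n) / c ^ n) \<longlonglongrightarrow> 0"
  using assms
proof (induction q arbitrary: c)
  case 0
  then show ?case by simp
next
  case (pCons a q)
  have s: "1 < sqrt c" using pCons.prems by simp
  have "(\<lambda>n. a / c ^ n + (real n / sqrt c ^ n) * (poly q (real n) / sqrt c ^ n)) \<longlonglongrightarrow> 0 + 0 * 0"
    using pCons.prems s
    by (intro tendsto_add tendsto_mult LIMSEQ_divide_realpow_zero pCons.IH lim_n_over_pown) simp_all
  moreover have "sqrt c ^ n * sqrt c ^ n = c ^ n" for n
    using pCons.prems by (simp flip: power_mult_distrib)
  ultimately show ?case by (simp add: add_divide_distrib)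
qed

lemma not_tame_if_exponential:
  assumes "\<And>n. G n \<in> \<G>" and "\<And>n. card (verts (G n)) = a * n + b" and "\<And>n. 2 ^ n \<le> num_min_seps (G n)"
  shows "\<not> tame \<G>"
proof
  assume "tame \<G>"
  then obtain p :: "real poly" where p: "\<And>G. G \<in> \<G> \<Longrightarrow> real (num_min_seps G) \<le> poly p (real (card (verts G)))"
    unfolding tame_def by blast
  define q where "q = pcompose p [:real b, real a:]"
  have "1 \<le> poly q (real n) / 2 ^ n" for n
  proof -
    have "2 ^ n \<le> real (num_min_seps (G n))" using assms(3)[of n] by (metis of_nat_le_iff of_nat_numeral of_nat_power)
    also have "\<dots> \<le> poly q (real n)"
      using p[OF assms(1), of n] by (simp add: q_def poly_pcompose assms(2) algebra_simps)
    finally show ?thesis by simp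
  qed
  moreover have "(\<lambda>n. poly q (real n) / 2 ^ n) \<longlonglongrightarrow> 0" by (rule poly_over_power_tendsto_0) simp
  ultimately have "(1 :: real) \<le> 0" by (intro LIMSEQ_le_const) auto
  then show False by simp
qed

lemma member_in_twin_if_tame:
  fixes H :: "nat \<Rightarrow> nat graph"
  assumes tame: "tame (free_class \<F>)"
    and H: "\<And>n. simple_graph (H n)" and C: "\<And>n. C n \<subseteq> verts (H n)"
    and "\<And>n. connected_in (H n) (verts (H n) - C n)"
    and "\<And>n c. c \<in> C n \<Longrightarrow> \<exists>l\<in>verts (H n) - C n. adjacent (H n) c l"
    and "\<And>n. card (C n) = n" and "\<And>n. card (verts (H n)) = a * n + b"
  shows "\<exists>X\<in>\<F>. \<exists>n. emb X (twin (H n) (C n))"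
proof (rule ccontr)
  assume "\<not> ?thesis"
  then have "twin (H n) (C n) \<in> free_class \<F>" for n
    unfolding free_class_def is_free_iff using simple_twin[OF H C] by blast
  moreover have "2 ^ n \<le> num_min_seps (twin (H n) (C n))" for n
    using num_min_seps_twin[OF assms(2-5), of n] assms(6) by simp
  moreover have "card (verts (twin (H n) (C n))) = (2 * a) * n + 2 * b" for n
    using card_verts_twin[OF H] assms(7) by simp
  ultimately have "\<not> tame (free_class \<F>)"
    by (intro not_tame_if_exponential[where G = "\<lambda>n. twin (H n) (C n)"])
  with tame show False by blast
qed

section \<open>The twins of stars, complete graphs and combs\<close>

text \<open>
  Even vertices form a path \<open>0, 2, ..., 2 * n\<close>, and each odd vertex is joined to the two even vertices next
  to it, which makes a chain of triangles.  Matching the odd vertices of two copies gives a claw-free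
  graph; it is a line graph.
\<close>

definition comb :: "nat \<Rightarrow> nat graph" where
  "comb n = \<lparr>verts = {..2 * n},
     edges = (\<lambda>i. {i, i + 1}) ` {..<2 * n} \<union> (\<lambda>i. {2 * i, 2 * i + 2}) ` {..<n}\<rparr>"

lemma adjacent_star:
  "adjacent (complete_bipartite 1 n) u v \<longleftrightarrow> u \<le> n \<and> v \<le> n \<and> (u = 0) \<noteq> (v = 0)"
  by (auto simp: adjacent_def complete_bipartite_def doubleton_eq_iff)

lemma adjacent_complete:
  "adjacent (complete_graph (Suc n)) u v \<longleftrightarrow> u \<le> n \<and> v \<le> n \<and> u \<noteq> v"
proof
  assume "u \<le> n \<and> v \<le> n \<and> u \<noteq> v"
  then have "u < v \<and> v < Suc n \<or> v < u \<and> u < Suc n" by auto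
  then show "adjacent (complete_graph (Suc n)) u v"
    unfolding adjacent_def complete_graph_def by (auto simp: insert_commute)
qed (auto simp: adjacent_def complete_graph_def doubleton_eq_iff)

lemma adjacent_comb:
  "adjacent (comb n) u v \<longleftrightarrow> u \<le> 2 * n \<and> v \<le> 2 * n \<and>
     (v = u + 1 \<or> u = v + 1 \<or> even u \<and> (v = u + 2 \<or> u = v + 2))"
proof
  assume r: "u \<le> 2 * n \<and> v \<le> 2 * n \<and> (v = u + 1 \<or> u = v + 1 \<or> even u \<and> (v = u + 2 \<or> u = v + 2))"
  have 1: "{x, x + 1} \<in> edges (comb n)" if "x + 1 \<le> 2 * n" for x
    using that unfolding comb_def by auto
  have 2: "{x, x + 2} \<in> edges (comb n)" if "even x" "x + 2 \<le> 2 * n" for x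
  proof -
    have "x = 2 * (x div 2)" "x div 2 < n" using that by auto
    then show ?thesis unfolding comb_def by auto
  qed
  show "adjacent (comb n) u v"
    using r 1[of u] 1[of v] 2[of u] 2[of v] unfolding adjacent_def by (auto simp: insert_commute)
qed (auto simp: adjacent_def comb_def doubleton_eq_iff)

lemma simple_star: "simple_graph (complete_bipartite 1 n)"
  by (auto simp: simple_graph_def complete_bipartite_def)

lemma simple_complete: "simple_graph (complete_graph (Suc n))"
  by (auto simp: simple_graph_def complete_graph_def)

lemma simple_comb: "simple_graph (comb n)"
  by (auto simp: simple_graph_def comb_def)

lemma connected_in_singleton: "v \<in> verts G \<Longrightarrow> connected_in G {v}"
  unfolding connected_in_def by blast

text \<open>
  The even vertices remain after deleting the matched ones; they form a path.
\<close>

lemma connected_in_comb: "connected_in (comb n) (verts (comb n) - {v. odd v})"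
  unfolding connected_in_def
proof (intro conjI allI impI)
  let ?L = "verts (comb n) - {v. odd v}"
  show "?L \<subseteq> verts (comb n)" "?L \<noteq> {}" by (auto simp: comb_def)
  fix X assume X: "X \<subseteq> ?L" "X \<noteq> {} \<and> (\<forall>x\<in>X. \<forall>y\<in>?L. adjacent (comb n) x y \<longrightarrow> y \<in> X)"
  then obtain x where x: "x \<in> X" by blast
  define i where "i = x div 2"
  have i: "2 * i \<in> X" "i \<le> n" using x X(1) by (auto simp: i_def comb_def)
  have step: "2 * j \<in> X" if "2 * k \<in> X" "j = Suc k \<or> k = Suc j" "j \<le> n" for j k
  proof -
    have "2 * k \<le> 2 * n" using that(1) X(1) by (auto simp: comb_def)
    then have "2 * j \<in> ?L" "adjacent (comb n) (2 * k) (2 * j)"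
      using that by (auto simp: adjacent_comb) (auto simp: comb_def)
    then show ?thesis using X(2) that(1) by blast
  qed
  have up: "i + k \<le> n \<Longrightarrow> 2 * (i + k) \<in> X" for k
  proof (induction k)
    case (Suc k)
    then show ?case using step[of "i + k" "Suc (i + k)"] by simp
  qed (use i in simp)
  have down: "k \<le> i \<Longrightarrow> 2 * (i - k) \<in> X" for k
  proof (induction k)
    case (Suc k)
    then show ?case using step[of "i - k" "i - Suc k"] i(2) by (simp add: Suc_diff_Suc)
  qed (use i in simp)
  have "2 * j \<in> X" if "j \<le> n" for j
    using up[of "j - i"] down[of "i - j"] that by (cases "i \<le> j") auto
  moreover have "\<exists>j\<le>n. v = 2 * j" if "v \<in> ?L" for v
    using that by (auto simp: comb_def elim!: evenE)
  ultimately have "?L \<subseteq> X" by blast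
  with X(1) show "X = ?L" by blast
qed

lemma theta_no_triangle: "\<not> has_triangle (twin (complete_bipartite 1 n) {1..n})"
  unfolding has_triangle_def adjacent_twin adjacent_star by (auto split: if_splits)

lemma theta_no_C4: "\<not> emb C4 (twin (complete_bipartite 1 n) {1..n})" (is "\<not> emb _ ?G")
proof
  have G: "simple_graph ?G"
    by (rule simple_twin[OF simple_star]) (auto simp: complete_bipartite_def)
  assume "emb C4 ?G"
  then obtain a b c d where ne: "a \<noteq> c" "b \<noteq> d"
    and adj: "adjacent ?G a b" "adjacent ?G b c" "adjacent ?G c d" "adjacent ?G a d"
    unfolding emb_C4[OF G] by auto
  have ne': "\<not> (even x = even y \<and> x div 2 = y div 2)" if "x \<noteq> y" for x y :: nat
    using that by presburger
  show False
    using adj ne'[OF ne(1)] ne'[OF ne(2)] unfolding adjacent_twin adjacent_star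
    by (auto split: if_splits)
qed

lemma prism_no_cotriangle: "\<not> has_cotriangle (twin (complete_graph (Suc n)) {1..n})" (is "\<not> has_cotriangle ?G")
proof
  assume "has_cotriangle ?G"
  then obtain a b c where V: "{a, b, c} \<subseteq> verts ?G" and ne: "a \<noteq> b" "a \<noteq> c" "b \<noteq> c"
    and adj: "\<not> adjacent ?G a b" "\<not> adjacent ?G a c" "\<not> adjacent ?G b c"
    unfolding has_cotriangle_def by auto
  have same: "adjacent ?G x y" if "even x = even y" "x \<noteq> y" "x \<in> verts ?G" "y \<in> verts ?G" for x y
  proof -
    have "x div 2 \<noteq> y div 2" using that(1,2) by presburger
    then show ?thesis
      using that unfolding adjacent_twin in_verts_twin adjacent_complete by (auto simp: complete_graph_def)
  qed
  show False using same[of a b] same[of a c] same[of b c] V ne adj by auto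
qed

lemma prism_no_diamond: "\<not> emb diamond (twin (complete_graph (Suc n)) {1..n})" (is "\<not> emb _ ?G")
proof
  have G: "simple_graph ?G"
    by (rule simple_twin[OF simple_complete]) (auto simp: complete_graph_def)
  assume "emb diamond ?G"
  then obtain a b c d where ne: "c \<noteq> d"
    and adj: "\<not> adjacent ?G a b" "adjacent ?G a c" "adjacent ?G a d"
       "adjacent ?G b c" "adjacent ?G b d" "adjacent ?G c d"
    and ab: "a \<noteq> b"
    unfolding emb_diamond[OF G] by auto
  have ne': "\<not> (even x = even y \<and> x div 2 = y div 2)" if "x \<noteq> y" for x y :: nat
    using that by presburger
  show False
    using adj ne'[OF ne] ne'[OF ab] unfolding adjacent_twin adjacent_complete
    by (auto split: if_splits)
qed

text \<open>
  Adjacency in the comb without the bound on the vertices.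
\<close>

definition strip :: "nat \<Rightarrow> nat \<Rightarrow> bool" where
  "strip u v \<longleftrightarrow> v = u + 1 \<or> u = v + 1 \<or> even u \<and> (v = u + 2 \<or> u = v + 2)"

lemma strip_sym: "strip u v \<Longrightarrow> strip v u"
  unfolding strip_def by auto

lemma strip_near: "strip u v \<Longrightarrow> u \<noteq> v \<and> u \<le> v + 2 \<and> v \<le> u + 2"
  by (auto simp: strip_def)

lemma strip_no_K4:
  assumes "strip a b" "strip a c" "strip a d" "strip b c" "strip b d" "strip c d"
  shows False
  using assms[THEN strip_near] by arith

lemma strip_third:
  assumes "strip a c" "strip a d" "strip c d" "c < d"
  shows "a = (if d = c + 2 then c + 1 else if even c then c + 2 else c - 1)"
proof -
  have "d = c + 1 \<or> even c \<and> d = c + 2" using assms(3,4) unfolding strip_def by arith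
  then show ?thesis
  proof
    assume "d = c + 1"
    then show ?thesis using assms(1,2) unfolding strip_def by simp presburger
  next
    assume "even c \<and> d = c + 2"
    then show ?thesis using assms(1,2) unfolding strip_def by simp presburger
  qed
qed

lemma strip_no_diamond:
  assumes "strip a c" "strip a d" "strip b c" "strip b d" "strip c d" 
  shows "a = b"
proof (cases "c < d")
  case True
  then show ?thesis using strip_third[of a c d] strip_third[of b c d] assms by simp
next
  case False
  then have "d < c" using strip_near[OF assms(5)] by simp
  then show ?thesis using strip_third[of a d c] strip_third[of b d c] assms strip_sym[OF assms(5)] by simp
qed

text \<open>
  Two neighbours on the same side of \<open>a\<close> are consecutive numbers, hence adjacent.
\<close>

lemma strip_between:
  assumes "strip a b" "strip a c" "b \<noteq> c" "\<not> strip b c"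
  shows "b < a \<and> a < c \<or> c < a \<and> a < b"
proof (rule ccontr)
  assume "\<not> ?thesis"
  then have "c = b + 1 \<or> b = c + 1"
    using assms(3) strip_near[OF assms(1)] strip_near[OF assms(2)] by arith
  with assms(4) show False by (auto simp: strip_def)
qed

lemma strip_odd:
  assumes "strip a b" "strip a c" "odd a" 
  shows "b = c \<or> strip b c"
  using assms unfolding strip_def by auto

abbreviation "comb_twin n \<equiv> twin (comb n) {v. odd v \<and> v \<le> 2 * n}"

lemma simple_comb_twin: "simple_graph (comb_twin n)"
  by (rule simple_twin[OF simple_comb]) (auto simp: comb_def)

lemma adjacent_comb_twin:
  assumes "x \<in> verts (comb_twin n)" "y \<in> verts (comb_twin n)"
  shows "adjacent (comb_twin n) x y \<longleftrightarrow> (if even x \<longleftrightarrow> even y then strip (x div 2) (y div 2)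
    else x div 2 = y div 2 \<and> odd (x div 2))"
proof -
  have "x div 2 \<le> 2 * n" "y div 2 \<le> 2 * n" using assms unfolding in_verts_twin by (simp_all add: comb_def)
  then show ?thesis unfolding adjacent_twin adjacent_comb strip_def by simp
qed

lemma half_eq_imp_eq: "even x = even y \<Longrightarrow> x div 2 = y div 2 \<Longrightarrow> x = (y :: nat)"
  by presburger

text \<open>
  Triangles never use a matching edge, so each lies in one of the two copies.
\<close>

lemma comb_twin_triangle:
  assumes V: "{x, y, z} \<subseteq> verts (comb_twin n)"
    and adj: "adjacent (comb_twin n) x y" "adjacent (comb_twin n) x z" "adjacent (comb_twin n) y z"
  shows "even x = even y"
proof (rule ccontr)
  assume xy: "even x \<noteq> even y"
  have V: "x \<in> verts (comb_twin n)" "y \<in> verts (comb_twin n)" "z \<in> verts (comb_twin n)" using V by auto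
  have "x div 2 = y div 2" using adj(1) xy unfolding adjacent_comb_twin[OF V(1,2)] by simp
  moreover have "x div 2 = z div 2 \<or> strip (x div 2) (z div 2)" "y div 2 = z div 2 \<or> strip (y div 2) (z div 2)"
    "even x = even z \<longrightarrow> strip (x div 2) (z div 2)" "even y = even z \<longrightarrow> strip (y div 2) (z div 2)"
    "even x \<noteq> even z \<longrightarrow> x div 2 = z div 2" "even y \<noteq> even z \<longrightarrow> y div 2 = z div 2"
    using adj(2,3) unfolding adjacent_comb_twin[OF V(1,3)] adjacent_comb_twin[OF V(2,3)]
    by (auto split: if_splits)
  ultimately show False using xy strip_near[of "z div 2" "z div 2"] by auto
qed

lemma comb_twin_no_K4: "\<not> emb K4 (comb_twin n)" (is "\<not> emb _ ?G")
proof
  assume "emb K4 ?G"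
  then obtain a b c d where V: "{a, b, c, d} \<subseteq> verts ?G"
    and adj: "adjacent ?G a b" "adjacent ?G a c" "adjacent ?G a d" "adjacent ?G b c" "adjacent ?G b d" "adjacent ?G c d"
    unfolding emb_K4[OF simple_comb_twin] by (elim exE conjE) (rule that; assumption)
  have v: "a \<in> verts ?G" "b \<in> verts ?G" "c \<in> verts ?G" "d \<in> verts ?G" using V by auto
  have "even a = even b" "even a = even c" "even a = even d"
    using comb_twin_triangle[of a b c n] comb_twin_triangle[of a c b n] comb_twin_triangle[of a d b n] v adj
    by (auto dest: adjacent_sym)
  then show False
    using adj v strip_no_K4[of "a div 2" "b div 2" "c div 2" "d div 2"] by (simp add: adjacent_comb_twin)
qed

lemma comb_twin_no_diamond: "\<not> emb diamond (comb_twin n)" (is "\<not> emb _ ?G")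
proof
  assume "emb diamond ?G"
  then obtain a b c d where V: "{a, b, c, d} \<subseteq> verts ?G" and ne: "distinct [a, b, c, d]"
    and adj: "adjacent ?G a c" "adjacent ?G a d" "adjacent ?G b c" "adjacent ?G b d" "adjacent ?G c d"
    unfolding emb_diamond[OF simple_comb_twin] by (elim exE conjE) (rule that; assumption)
  have v: "a \<in> verts ?G" "b \<in> verts ?G" "c \<in> verts ?G" "d \<in> verts ?G" using V by auto
  have s: "even a = even c" "even b = even c" "even c = even d"
    using comb_twin_triangle[of a c d n] comb_twin_triangle[of b c d n] comb_twin_triangle[of c d a n] v adj
    by (auto dest: adjacent_sym)
  then have "a div 2 = b div 2"
    using adj v strip_no_diamond[of "a div 2" "c div 2" "d div 2" "b div 2"] by (simp add: adjacent_comb_twin)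
  then show False using half_eq_imp_eq[of a b] s ne by simp
qed

lemma comb_twin_between:
  assumes v: "a \<in> verts (comb_twin n)" "b \<in> verts (comb_twin n)" "c \<in> verts (comb_twin n)"
    and ne: "b \<noteq> c" and side: "even a = even b" "even a = even c"
    and adj: "adjacent (comb_twin n) a b" "adjacent (comb_twin n) a c" "\<not> adjacent (comb_twin n) b c"
  shows "b div 2 < a div 2 \<and> a div 2 < c div 2 \<or> c div 2 < a div 2 \<and> a div 2 < b div 2"
  using adj strip_between[of "a div 2" "b div 2" "c div 2"] half_eq_imp_eq[of b c] ne side
  unfolding adjacent_comb_twin[OF v(1,2)] adjacent_comb_twin[OF v(1,3)] adjacent_comb_twin[OF v(2,3)]
  by auto

lemma comb_twin_cross:
  assumes V: "{a, b, c} \<subseteq> verts (comb_twin n)" and ne: "b \<noteq> c"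
    and adj: "adjacent (comb_twin n) a b" "adjacent (comb_twin n) a c" and cross: "even a \<noteq> even b"
  shows "even a = even c" "odd (a div 2)" "even (c div 2)"
proof -
  have v: "a \<in> verts (comb_twin n)" "b \<in> verts (comb_twin n)" "c \<in> verts (comb_twin n)" using V by auto
  have "a div 2 = b div 2 \<and> odd (a div 2)"
    using adj(1) unfolding adjacent_comb_twin[OF v(1,2)] if_not_P[OF cross] .
  note b = conjunct1[OF this] conjunct2[OF this]
  then show "odd (a div 2)" by simp
  show *: "even a = even c"
  proof (rule ccontr)
    assume "even a \<noteq> even c"
    then show False
      using adj(2) cross b half_eq_imp_eq[of b c] ne unfolding adjacent_comb_twin[OF v(1,3)] by auto
  qed
  show "even (c div 2)"
    using adj(2) * b(2) unfolding adjacent_comb_twin[OF v(1,3)] strip_def by auto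
qed

lemma comb_twin_no_claw: "\<not> emb claw (comb_twin n)" (is "\<not> emb _ ?G")
proof
  assume "emb claw ?G"
  then obtain a b c d where V: "{a, b, c, d} \<subseteq> verts ?G" and ne: "distinct [a, b, c, d]"
    and adj: "adjacent ?G a b" "adjacent ?G a c" "adjacent ?G a d"
      "\<not> adjacent ?G b c" "\<not> adjacent ?G b d" "\<not> adjacent ?G c d"
    unfolding emb_claw[OF simple_comb_twin] by (elim exE conjE) (rule that; assumption)
  have v: "a \<in> verts ?G" "b \<in> verts ?G" "c \<in> verts ?G" "d \<in> verts ?G" using V by auto
  have odd: False if "even a \<noteq> even x" "y \<noteq> z" "x \<noteq> y" "x \<noteq> z" "adjacent ?G a x" "adjacent ?G a y" "adjacent ?G a z"
      "\<not> adjacent ?G y z" "{x, y, z} \<subseteq> verts ?G" for x y z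
  proof -
    have w: "y \<in> verts ?G" "z \<in> verts ?G" using that(9) by auto
    have y: "even a = even y" "odd (a div 2)" using comb_twin_cross[of a x y n] that v(1) by auto
    have z: "even a = even z" using comb_twin_cross[of a x z n] that v(1) by auto
    show False
      using strip_odd[of "a div 2" "y div 2" "z div 2"] that(2,6-8) y z half_eq_imp_eq[of y z]
      by (auto simp: adjacent_comb_twin v w)
  qed
  have s: "even a = even b" "even a = even c" "even a = even d"
    using odd[of b c d] odd[of c b d] odd[of d b c] v ne adj by auto
  have d: "b \<noteq> c" "b \<noteq> d" "c \<noteq> d" using ne by auto
  show False
    using comb_twin_between[OF v(1,2,3) d(1) s(1,2) adj(1,2,4)]
      comb_twin_between[OF v(1,2,4) d(2) s(1,3) adj(1,3,5)]
      comb_twin_between[OF v(1,3,4) d(3) s(2,3) adj(2,3,6)] by linarith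
qed

text \<open>
  Inside one copy, each vertex of an induced C4 would lie strictly between its two neighbours,
  which fails for the largest one.
\<close>

lemma comb_twin_no_C4: "\<not> emb C4 (comb_twin n)" (is "\<not> emb _ ?G")
proof
  assume "emb C4 ?G"
  then obtain a b c d where V: "{a, b, c, d} \<subseteq> verts ?G" and ne: "distinct [a, b, c, d]"
    and adj: "adjacent ?G a b" "\<not> adjacent ?G a c" "adjacent ?G a d"
      "adjacent ?G b c" "\<not> adjacent ?G b d" "adjacent ?G c d"
    unfolding emb_C4[OF simple_comb_twin] by (elim exE conjE) (rule that; assumption)
  have v: "a \<in> verts ?G" "b \<in> verts ?G" "c \<in> verts ?G" "d \<in> verts ?G" using V by auto
  note adj' = adj(1,3,4,6)[THEN adjacent_sym]
  \<comment> \<open>a cycle through a matching edge would have to use a second one, whose ends have even index\<close>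
  have side: "even x = even y"
    if "{x, y, z, w} \<subseteq> verts ?G" "distinct [x, y, z, w]" "adjacent ?G x y" "adjacent ?G y z" "adjacent ?G z w" "adjacent ?G x w"
    for x y z w
  proof (rule ccontr)
    assume xy: "even x \<noteq> even y"
    have w: "even x = even w" "even (w div 2)" using comb_twin_cross[of x y w n] that xy by auto
    have z: "even y = even z" using comb_twin_cross[of y x z n] that xy adjacent_sym[OF that(3)] by auto
    have v: "w \<in> verts ?G" "z \<in> verts ?G" using that(1) by auto
    show False
      using that(5) adjacent_sym[OF that(5)] w z xy by (auto simp: adjacent_comb_twin v)
  qed
  have "even a = even b" by (rule side[of a b c d]) (use v ne adj in simp_all)
  moreover have "even b = even c" by (rule side[of b c d a]) (use v ne adj adj' in auto)
  moreover have "even c = even d" by (rule side[of c d a b]) (use v ne adj adj' in auto)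
  ultimately have s: "even a = even b" "even b = even c" "even c = even d" "even a = even d"
    by simp_all
  have d: "b \<noteq> d" "a \<noteq> c" using ne by auto
  show False
    using comb_twin_between[OF v(1,2,4) d(1) s(1,4) adj(1,3,5)]
      comb_twin_between[OF v(2,1,3) d(2) s(1)[symmetric] s(2) adj'(1) adj(4,2)]
      comb_twin_between[OF v(3,2,4) d(1) s(2)[symmetric] s(3) adj'(3) adj(6,5)]
      comb_twin_between[OF v(4,1,3) d(2) s(4)[symmetric] s(3)[symmetric] adj'(2,4) adj(2)] by linarith
qed

section \<open>The dichotomy\<close>

lemma emb_if_graph_iso: "graph_iso H X \<Longrightarrow> emb H G \<Longrightarrow> simple_graph H \<Longrightarrow> emb X G"
proof -
  assume iso: "graph_iso H X" and emb: "emb H G" and H: "simple_graph H"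
  have "induced H (verts H) = H"
    using H by (cases H) (auto simp: induced_def simple_graph_def)
  then have "emb X H" unfolding emb_iff_induced using iso by (intro exI[of _ "verts H"]) simp
  then show "emb X G" using emb by (rule emb_trans)
qed

lemma has_triangle_mono: "emb H G \<Longrightarrow> simple_graph H \<Longrightarrow> has_triangle H \<Longrightarrow> has_triangle G"
  unfolding has_triangle_def by (elim embE) (metis adjacent_verts(1,2))

lemma has_cotriangle_mono:
  assumes "emb H G" "has_cotriangle H"
  shows "has_cotriangle G"
proof -
  obtain f where f: "inj_on f (verts H)" "f ` verts H \<subseteq> verts G"
      "\<And>u v. u \<in> verts H \<Longrightarrow> v \<in> verts H \<Longrightarrow> adjacent H u v \<longleftrightarrow> adjacent G (f u) (f v)"
    using assms(1) by (rule embE) blast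
  obtain a b c where abc: "a \<in> verts H" "b \<in> verts H" "c \<in> verts H" "a \<noteq> b" "a \<noteq> c" "b \<noteq> c"
      "\<not> adjacent H a b" "\<not> adjacent H a c" "\<not> adjacent H b c"
    using assms(2) unfolding has_cotriangle_def by auto
  show ?thesis
    unfolding has_cotriangle_def
    using abc f(3) inj_on_eq_iff[OF f(1)] f(2)
    by (intro exI[of _ "f a"] exI[of _ "f b"] exI[of _ "f c"]) auto
qed

lemma C4_no_cotriangle: "\<not> has_cotriangle C4"
proof
  assume "has_cotriangle C4"
  then obtain a b c where V: "a \<in> verts C4" "b \<in> verts C4" "c \<in> verts C4" and ne: "a \<noteq> b" "a \<noteq> c" "b \<noteq> c"
    and "\<not> adjacent C4 a b" "\<not> adjacent C4 a c" "\<not> adjacent C4 b c"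
    unfolding has_cotriangle_def by auto
  moreover have "x = y + 2 \<or> y = x + 2"
    if "x \<in> verts C4" "y \<in> verts C4" "x \<noteq> y" "\<not> adjacent C4 x y" for x y
    using that unfolding cycle_graph_4 by (auto simp: adjacent_explicit doubleton_eq_iff)
  ultimately have "a = b + 2 \<or> b = a + 2" "a = c + 2 \<or> c = a + 2" "b = c + 2 \<or> c = b + 2"
    by blast+
  moreover have "a \<le> 3" "b \<le> 3" "c \<le> 3" using V unfolding cycle_graph_4 by auto
  ultimately show False by linarith
qed

lemma tame_if_le:
  assumes le: "\<F> \<unlhd> \<F>'"
    and described: "\<And>(G :: nat graph) S A B. simple_graph G \<Longrightarrow> \<forall>X\<in>\<F>'. \<not> emb X G \<Longrightarrow>
      full_pair G S A B \<Longrightarrow> described 9 G S"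
  shows "tame (free_class \<F>)"
proof (rule tame_if_described)
  fix G S assume G: "G \<in> free_class \<F>" and S: "minimal_separator G S"
  then have "simple_graph G" "\<forall>X\<in>\<F>'. \<not> emb X G"
    using le unfolding family_le_def free_class_def is_free_iff by blast+
  with described minimal_separator_full_pair[OF _ S] show "described 9 G S" by blast
qed (simp add: free_class_def)

text \<open>
  A tame class cannot contain any of the three exponential families, so each of them contains a
  member of \<open>\<F>\<close>.
\<close>

lemma tame_imp_members:
  assumes "tame (free_class \<F>)"
  shows "\<exists>X\<in>\<F>. \<exists>n. emb X (twin (complete_bipartite 1 n) {1..n})"
    and "\<exists>X\<in>\<F>. \<exists>n. emb X (twin (complete_graph (Suc n)) {1..n})"
    and "\<exists>X\<in>\<F>. \<exists>n. emb X (comb_twin n)"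
proof -
  have star: "verts (complete_bipartite 1 n) = {..n}" for n
    by (auto simp: complete_bipartite_def)
  have complete: "verts (complete_graph (Suc n)) = {..n}" for n
    by (auto simp: complete_graph_def)
  have comb: "verts (comb n) = {..2 * n}" for n by (simp add: comb_def)
  have 0: "{..n} - {1..n} = {0 :: nat}" for n by auto
  have odds: "{v. odd v \<and> v \<le> 2 * n} = (\<lambda>i. 2 * i + 1) ` {..<n}" for n :: nat
    by (auto elim!: oddE)
  show "\<exists>X\<in>\<F>. \<exists>n. emb X (twin (complete_bipartite 1 n) {1..n})"
    by (rule member_in_twin_if_tame[OF assms, where a = 1 and b = 1])
      (auto simp: star 0 simple_star connected_in_singleton adjacent_star
        simp del: One_nat_def)
  show "\<exists>X\<in>\<F>. \<exists>n. emb X (twin (complete_graph (Suc n)) {1..n})"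
    by (rule member_in_twin_if_tame[OF assms, where a = 1 and b = 1])
      (auto simp: complete 0 simple_complete connected_in_singleton adjacent_complete simp del: One_nat_def)
  have L: "verts (comb n) - {v. odd v \<and> v \<le> 2 * n} = verts (comb n) - {v. odd v}" for n
    by (auto simp: comb)
  have "\<exists>l\<in>verts (comb n) - {v. odd v}. adjacent (comb n) c l" if "odd c" "c \<le> 2 * n" for c n
    using that by (intro bexI[of _ "c - 1"]) (auto simp: comb adjacent_comb elim!: oddE)
  moreover have "card {v. odd v \<and> v \<le> 2 * n} = n" for n
    unfolding odds by (simp add: card_image inj_on_def)
  ultimately show "\<exists>X\<in>\<F>. \<exists>n. emb X (comb_twin n)"
    by (intro member_in_twin_if_tame[OF assms, where a = 2 and b = 1])
      (auto simp: L connected_in_comb simple_comb, auto simp: comb)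
qed

text \<open>
  Given a tame class, the three constructions provide members of \<open>\<F>\<close>: one that is a forest, one
  without three independent vertices that is not the diamond, and one that is none of the claw, the
  diamond, K4 and C4.  Propositional reasoning about which forbidden graphs contain members of
  \<open>\<F>\<close> then leaves only families that consist, up to isomorphism, of 4P1, C4 and possibly the claw.
\<close>

theorem theorem3:
  fixes \<F> :: "nat graph set"
  assumes "\<forall>G\<in>\<F>. simple_graph G \<and> card (verts G) \<le> 4"
    and "\<not> family_eq \<F> {copies 4 (path_graph 1), cycle_graph 4}"
    and "\<not> family_eq \<F> {copies 4 (path_graph 1), claw, cycle_graph 4}"
  shows "tame (free_class \<F>) \<longleftrightarrow>
      (\<F> \<unlhd> {path_graph 4} \<or> \<F> \<unlhd> {copies 2 (path_graph 2)})
    \<or> (\<exists>F \<in> {copies 4 (path_graph 1), path_graph 2 \<oplus> copies 2 (path_graph 1),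
              path_graph 3 \<oplus> path_graph 1, claw}. \<F> \<unlhd> {F, paw})
    \<or> (\<exists>F \<in> {copies 4 (path_graph 1), path_graph 2 \<oplus> copies 2 (path_graph 1),
              path_graph 3 \<oplus> path_graph 1, claw}. \<F> \<unlhd> {F, complete_graph 3 \<oplus> path_graph 1})
    \<or> (\<exists>F \<in> {copies 4 (path_graph 1), path_graph 2 \<oplus> copies 2 (path_graph 1),
              path_graph 3 \<oplus> path_graph 1}. \<F> \<unlhd> {F, complete_graph 4})
    \<or> (\<exists>F \<in> {path_graph 2 \<oplus> copies 2 (path_graph 1),
              path_graph 3 \<oplus> path_graph 1}. \<F> \<unlhd> {F, cycle_graph 4})
    \<or> \<F> \<unlhd> {copies 4 (path_graph 1), cycle_graph 4, diamond}"
    (is "?tame \<longleftrightarrow> ?rhs")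
proof
  assume ?rhs
  then consider "\<F> \<unlhd> {P4}" | "\<F> \<unlhd> {TwoP2}"
    | F where "F \<in> {FourP1, P2_2P1, P3_P1}" "\<F> \<unlhd> {F, paw} \<or> \<F> \<unlhd> {F, K3_P1} \<or> \<F> \<unlhd> {F, K4}"
    | "\<F> \<unlhd> {claw, paw} \<or> \<F> \<unlhd> {claw, K3_P1}"
    | F where "F \<in> {P2_2P1, P3_P1}" "\<F> \<unlhd> {F, C4}"
    | "\<F> \<unlhd> {FourP1, C4, diamond}" by blast
  then show ?tame
  proof cases
    case 1
    then show ?thesis
      by (rule tame_if_le) (auto intro: described_mono[OF described_if_no_P4])
  next
    case 2
    then show ?thesis
      by (rule tame_if_le) (auto intro: described_mono[OF described_if_no_TwoP2])
  next
    case 3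
    have "described 9 G S"
      if "simple_graph G" "full_pair G S A B" "\<not> emb F G" "\<not> emb paw G \<or> \<not> emb K3_P1 G \<or> \<not> emb K4 G"
      for G :: "nat graph" and S A B
      using described_mono[OF described_if_clique_side[OF that(1,2) _ that(4)], of 9] 3(1) that(3) by auto
    then show ?thesis using 3(2) by (elim disjE) (erule tame_if_le, simp)+
  next
    case 4
    have "described 9 G S"
      if "simple_graph G" "full_pair G S A B" "\<not> emb claw G" "\<not> emb paw G \<or> \<not> emb K3_P1 G"
      for G :: "nat graph" and S A B
      using described_mono[OF described_if_claw_free[OF that], of 9] by simp
    then show ?thesis using 4 by (elim disjE) (erule tame_if_le, simp)+
  next
    case 5
    have "described 9 G S"
      if "simple_graph G" "full_pair G S A B" "\<not> emb F G" "\<not> emb C4 G"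
      for G :: "nat graph" and S A B
      using described_mono[OF described_if_C4_free[OF that(1,2,4)], of 9] 5(1) that(3) by auto
    then show ?thesis using 5(2) by (elim tame_if_le) simp
  next
    case 6
    then show ?thesis
      by (rule tame_if_le) (auto intro: described_if_C4_diamond_free)
  qed
next
  assume tame: ?tame
  define ok :: "nat graph \<Rightarrow> bool" where "ok X \<longleftrightarrow> (\<exists>H\<in>\<F>. emb H X)" for X
  have le1: "\<F> \<unlhd> {X}" if "ok X" for X :: "nat graph"
    using that by (intro family_leI) (auto simp: ok_def)
  have le2: "\<F> \<unlhd> {X, Y}" if "ok X" "ok Y" for X Y :: "nat graph"
    using that by (intro family_leI) (auto simp: ok_def)
  have le3: "\<F> \<unlhd> {X, Y, Z}" if "ok X" "ok Y" "ok Z" for X Y Z :: "nat graph"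
    using that by (intro family_leI) (auto simp: ok_def)
  have okI: "ok X" if "H \<in> \<F>" "emb H X" for H X using that by (auto simp: ok_def)
  have iso: "ok X" if "H \<in> \<F>" "graph_iso H X" for H X using okI graph_iso_imp_emb that by blast
  have simple: "simple_graph H" if "H \<in> \<F>" for H using assms(1) that by blast
  have cases: "ok P4 \<or> ok TwoP2 \<or> graph_iso H C4 \<or>
    has_cotriangle H \<and> (graph_iso H FourP1 \<or> ok P2_2P1 \<or> ok P3_P1 \<or> graph_iso H claw) \<or>
    has_triangle H \<and> (ok K3_P1 \<or> ok paw \<or> graph_iso H diamond \<or> graph_iso H K4)" if "H \<in> \<F>" for H
    using classification[of H] assms(1) that okI by metis
  show ?rhs
  proof (rule ccontr)
    assume no: "\<not> ?rhs"
    have n1: "\<not> ok P4" "\<not> ok TwoP2" using no le1 by blast+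
    have n2: "\<not> (ok X \<and> ok paw)" "\<not> (ok X \<and> ok K3_P1)" if "X \<in> {FourP1, P2_2P1, P3_P1, claw}" for X
      using no le2 that by blast+
    have n3: "\<not> (ok X \<and> ok K4)" if "X \<in> {FourP1, P2_2P1, P3_P1}" for X
      using no le2 that by blast
    have n4: "\<not> (ok X \<and> ok C4)" if "X \<in> {P2_2P1, P3_P1}" for X
      using no le2 that by blast
    have n5: "\<not> (ok FourP1 \<and> ok C4 \<and> ok diamond)" using no le3 by blast
    obtain H1 n1' where H1: "H1 \<in> \<F>" "emb H1 (twin (complete_bipartite 1 n1') {1..n1'})"
      using tame_imp_members(1)[OF tame] by blast
    have "\<not> has_triangle H1" "\<not> graph_iso H1 C4"
      using has_triangle_mono[OF H1(2) simple[OF H1(1)]] theta_no_triangle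
        emb_if_graph_iso[OF _ H1(2) simple[OF H1(1)]] theta_no_C4 by blast+
    then have c1: "ok FourP1 \<or> ok P2_2P1 \<or> ok P3_P1 \<or> ok claw"
      using cases[OF H1(1)] n1 iso[OF H1(1)] by blast
    obtain H2 n2' where H2: "H2 \<in> \<F>" "emb H2 (twin (complete_graph (Suc n2')) {1..n2'})"
      using tame_imp_members(2)[OF tame] by blast
    have "\<not> has_cotriangle H2" "\<not> graph_iso H2 diamond"
      using has_cotriangle_mono[OF H2(2)] prism_no_cotriangle
        emb_if_graph_iso[OF _ H2(2) simple[OF H2(1)]] prism_no_diamond by blast+
    then have c2: "ok C4 \<or> ok K3_P1 \<or> ok paw \<or> ok K4"
      using cases[OF H2(1)] n1 iso[OF H2(1)] by blast
    obtain H3 n3' where H3: "H3 \<in> \<F>" "emb H3 (comb_twin n3')"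
      using tame_imp_members(3)[OF tame] by blast
    have "\<not> graph_iso H3 C4" "\<not> graph_iso H3 claw" "\<not> graph_iso H3 diamond" "\<not> graph_iso H3 K4"
      using emb_if_graph_iso[OF _ H3(2) simple[OF H3(1)]] comb_twin_no_C4 comb_twin_no_claw
        comb_twin_no_diamond comb_twin_no_K4 by blast+
    then have c3: "ok FourP1 \<or> ok P2_2P1 \<or> ok P3_P1 \<or> ok K3_P1 \<or> ok paw"
      using cases[OF H3(1)] n1 iso[OF H3(1)] by blast
    have "ok FourP1 \<and> ok C4 \<and> \<not> ok P2_2P1 \<and> \<not> ok P3_P1 \<and> \<not> ok K3_P1 \<and> \<not> ok paw \<and> \<not> ok K4 \<and> \<not> ok diamond"
      using c1 c2 c3 n2[of FourP1] n2[of P2_2P1] n2[of P3_P1] n2[of claw] n3[of FourP1] n3[of P2_2P1]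
        n3[of P3_P1] n4[of P2_2P1] n4[of P3_P1] n5 by simp blast
    then have ok: "ok FourP1" "ok C4" and not_ok: "\<not> ok P2_2P1" "\<not> ok P3_P1" "\<not> ok K3_P1"
      "\<not> ok paw" "\<not> ok K4" "\<not> ok diamond" by blast+
    have only: "graph_iso H C4 \<or> has_cotriangle H \<and> (graph_iso H FourP1 \<or> graph_iso H claw)" if "H \<in> \<F>" for H
      using cases[OF that] n1 not_ok iso[OF that] by blast
    \<comment> \<open>the remaining families are exactly the two excluded ones\<close>
    obtain H where H: "H \<in> \<F>" "emb H FourP1" using ok(1) by (auto simp: ok_def)
    have "\<not> emb C4 FourP1" "\<not> emb claw FourP1"
      unfolding emb_C4[OF simple_small_graphs(3)] emb_claw[OF simple_small_graphs(3)]
      by (simp_all add: adjacent_def small_graphs del: One_nat_def)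
    then have H4: "graph_iso H FourP1"
      using only[OF H(1)] emb_if_graph_iso[OF _ H(2) simple[OF H(1)]] by blast
    obtain K where K: "K \<in> \<F>" "emb K C4" using ok(2) by (auto simp: ok_def)
    then have K4: "graph_iso K C4"
      using only[OF K(1)] has_cotriangle_mono[OF K(2)] C4_no_cotriangle by blast
    show False
    proof (cases "\<exists>L\<in>\<F>. graph_iso L claw")
      case True
      then have "family_eq \<F> {FourP1, claw, C4}"
        unfolding family_eq_def using only H(1) H4 K(1) K4 by auto
      with assms(3) show False by blast
    next
      case False
      then have "family_eq \<F> {FourP1, C4}"
        unfolding family_eq_def using only H(1) H4 K(1) K4 by auto
      with assms(2) show False by blast
    qed
  qed
qed

end
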